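(* Suppose $p\ne 2$. Then $\phi_1$ has degree $p-2$ (i.e. for every $x\in\phi_1(M)$ the fiber $\phi_1^{-1}(x)$ has exactly $p-2$ points counted with multiplicity), and $$\phi_1(M)=\{x\in O_p: |A_{p-2}(x)|>p^{-1/(p-1)}\}.$$ If $(x,q)\in M$, then $|A_{p-2}(x)|=p^{(p-2)m_0-1}$, where $m_0=v(q-1)$.
   Context: Let $p$ be a prime, $\mathbb{C}_p$ the $p$-adic complex numbers with absolute value $|\cdot|$ and additive valuation $v$, $|x|=p^{-v(x)}$, $v(p)=1$. Let $O_p=\{x\in\mathbb{C}_p:|x|\le 1\}$ and $B(a,r)=\{b\in\mathbb{C}_p:|b-a|<r\}$. For $x\in O_p$ and $q\in B(1,p^{-1/(p-1)})$ put $q^x=\exp(x\log q)$ ($p$-adic $\exp$ and $\log$), and define the $q$-bracket by $[x]_q=\frac{q^x-1}{q-1}$ if $q\ne 1$ and $[x]_1=x$. Set $A_0(X)=1$ and $A_n(X)=(X-2)(X-3)\cdots(X-(n+1))$ for $n>0$. The equation $[x]_q=x$ has the trivial solutions $q=1$, $x=0$, $x=1$. To remove them, let $g(X,Q)=\frac{[X]_Q-X}{(Q-1)X(X-1)}$, understood as the analytic function on $O_p\times B(1,p^{-1/(p-1)})$ given by the convergent series $g(X,Q)=\sum_{n\ge 0}\frac{A_n(X)}{(n+2)!}(Q-1)^n$. Define $M=\{(x,q)\in O_p\times B(1,p^{-1/(p-1)}): g(x,q)=0\}$ (the set of nontrivial fixed points), and let $\phi_1:M\to O_p$ be the projection $(x,q)\mapsto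 x$. The multiplicity of a point $(x,q)$ in the fiber $\phi_1^{-1}(x)$ is the order of vanishing at $Q=q$ of the one-variable analytic function $g(x,Q)$. *)

theory Defs
  imports
    "HOL-Analysis.Analysis"
    "HOL-Computational_Algebra.Computational_Algebra"
begin

text \<open>
  The library's \<open>norm\<close> is constrained to real normed vector spaces, so the absolute value needs
  its own constant.  Nonnegativity and definiteness come from \<open>dist\<close>.
\<close>

class ultrametric_field = field_char_0 + metric_space +
  fixes absval :: "'a \<Rightarrow> real"
  assumes dist_absval: "dist x y = absval (x - y)"
    and absval_mult: "absval (x * y) = absval x * absval y"
    and absval_add_le_max: "absval (x + y) \<le> max (absval x) (absval y)"

text \<open>
  The field \<open>\<complex>\<^sub>p\<close> is the completion of an algebraic closure of \<open>\<rat>\<^sub>p\<close>, and \<open>\<rat>\<^sub>p\<close> is the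
  completion of \<open>\<rat>\<close> for the absolute value with \<open>\<bar>p\<bar> = 1/p\<close>.  It is axiomatised here, up to
  isometric isomorphism, as a complete algebraically closed field in which \<open>\<bar>p\<bar> = 1/p\<close> and the
  elements algebraic over \<open>\<rat>\<^sub>p\<close> are dense; \<open>\<rat>\<^sub>p\<close> is the closure of \<open>\<rat>\<close> in such a field.
  The prime is not part of the type, hence the split into a class and a predicate.
\<close>

class complete_alg_closed_ultrametric_field =
  ultrametric_field + complete_space + alg_closed_field

definition Q_p :: "'a::ultrametric_field set" where
  "Q_p = closure \<rat>"

definition is_C_p :: "nat \<Rightarrow> 'a::complete_alg_closed_ultrametric_field itself \<Rightarrow> bool" where
  "is_C_p p (_ :: 'a itself) \<longleftrightarrow>
     prime p \<and>
     absval (of_nat p :: 'a) = 1 / real p \<and>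
     closure {x :: 'a. \<exists>P. P \<noteq> 0 \<and> (\<forall>i. coeff P i \<in> Q_p) \<and> poly P x = 0} = UNIV"

definition O_p :: "'a::ultrametric_field set" where
  "O_p = {x. absval x \<le> 1}"

text \<open>The valuation is only meaningful at \<open>x \<noteq> 0\<close>, where it is real-valued.\<close>

definition valuation :: "nat \<Rightarrow> 'a::ultrametric_field \<Rightarrow> real" where
  "valuation p x = - log (real p) (absval x)"

definition q_disc :: "nat \<Rightarrow> 'a::ultrametric_field set" where
  "q_disc p = ball 1 (real p powr (- 1 / (real p - 1)))"

definition A :: "nat \<Rightarrow> 'a::ultrametric_field \<Rightarrow> 'a" where
  "A n X = (\<Prod>k=2..n+1. X - of_nat k)"

text \<open>
  Expanding \<open>Q\<^sup>X\<close> as the binomial series in \<open>Q - 1\<close>, this is the analytic continuation of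
  \<open>([X]\<^sub>Q - X) / ((Q - 1) X (X - 1))\<close>, where \<open>[X]\<^sub>Q = (Q\<^sup>X - 1) / (Q - 1)\<close>.
\<close>

definition g :: "'a::ultrametric_field \<Rightarrow> 'a \<Rightarrow> 'a" where
  "g X Q = (\<Sum>n. A n X / fact (n + 2) * (Q - 1) ^ n)"

definition M :: "nat \<Rightarrow> ('a::ultrametric_field \<times> 'a) set" where
  "M p = {(x, q). x \<in> O_p \<and> q \<in> q_disc p \<and> g x q = 0}"

definition \<phi>\<^sub>1 :: "'a \<times> 'a \<Rightarrow> 'a" where
  "\<phi>\<^sub>1 = fst"

definition fiber :: "nat \<Rightarrow> 'a::ultrametric_field \<Rightarrow> ('a \<times> 'a) set" where
  "fiber p x = {z \<in> M p. \<phi>\<^sub>1 z = x}"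

text \<open>
  The power series expansion of \<open>f\<close> at \<open>q\<close>.  The library's \<open>has_fps_expansion\<close> does not apply,
  as it requires a real normed algebra.
\<close>

definition has_expansion_at ::
    "('a::ultrametric_field \<Rightarrow> 'a) \<Rightarrow> 'a \<Rightarrow> 'a fps \<Rightarrow> bool" where
  "has_expansion_at f q F \<longleftrightarrow>
     (\<exists>r>0. \<forall>Q\<in>ball q r. (\<lambda>k. fps_nth F k * (Q - q) ^ k) sums f Q)"

text \<open>
  Meaningful for \<open>f\<close> analytic and not identically zero near \<open>q\<close> (the zero series would get order
  \<open>0\<close>).  This covers every \<open>g x\<close> on the disc, since \<open>g x 1 = 1/2\<close>.
\<close>

definition vanishing_order :: "('a::ultrametric_field \<Rightarrow> 'a) \<Rightarrow> 'a \<Rightarrow> nat" where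
  "vanishing_order f q = subdegree (THE F. has_expansion_at f q F)"

definition multiplicity_in_fiber :: "'a::ultrametric_field \<times> 'a \<Rightarrow> nat" where
  "multiplicity_in_fiber z = vanishing_order (g (fst z)) (snd z)"

definition \<phi>\<^sub>1_has_degree :: "nat \<Rightarrow> 'a::ultrametric_field itself \<Rightarrow> nat \<Rightarrow> bool" where
  "\<phi>\<^sub>1_has_degree p (_ :: 'a itself) d \<longleftrightarrow>
     (\<forall>x \<in> \<phi>\<^sub>1 ` (M p :: ('a \<times> 'a) set).
        finite (fiber p x) \<and> (\<Sum>z\<in>fiber p x. multiplicity_in_fiber z) = d)"

end

theory Submission
  imports Defs
begin

text \<open>
  For fixed \<open>x\<close> put \<open>t = q - 1\<close> and view \<open>g x q\<close> as a power series in \<open>t\<close> with coefficients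
  \<open>c n = A n x / (n + 2)!\<close>, on the disc \<open>\<bar>t\<bar> < \<rho>\<close> with \<open>\<rho> = p powr (- 1 / (p - 1))\<close>. Everything is
  read off its Newton polygon, on which only the indices \<open>0\<close> and \<open>e = p - 2\<close> matter. The constant
  term is the unit \<open>1/2\<close>, since \<open>p\<close> is odd. For \<open>0 < n < e\<close> the denominators are still units, so
  these terms are smaller than the constant term. The denominator at \<open>e\<close> is \<open>p!\<close>, the first one
  divisible by \<open>p\<close>. For \<open>n > e\<close> the numerator is a multiple of \<open>A e x\<close>, and Legendre's bound on
  \<open>(n + 2)!\<close>, which is sharp at \<open>p!\<close>, makes the term smaller than the one at \<open>e\<close> on all of the open
  disc of radius \<open>\<rho>\<close>.

  At a zero the two remaining terms must have the same absolute value, because a strictly dominant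
  term prevents a sum from vanishing in an ultrametric field. Hence
  \<open>\<bar>A e x\<bar> * p * \<bar>t\<bar> ^ e = 1\<close>, which is the formula for \<open>\<bar>A e x\<bar>\<close>; with \<open>\<bar>t\<bar> < \<rho>\<close> it gives
  \<open>\<bar>A e x\<bar> > \<rho>\<close>. Conversely, if \<open>\<bar>A e x\<bar> > \<rho>\<close> then the radius \<open>r\<close> with
  \<open>\<bar>A e x\<bar> * p * r ^ e = 1\<close> is less than \<open>\<rho>\<close>, and on the closed disc of radius \<open>r\<close> the last dominant
  term is the one of index \<open>e\<close>. By Weierstrass theory the series has exactly \<open>e\<close> zeros there, with
  multiplicity, and by the formula there are no others in the larger disc.

  The count rests on two facts about a power series whose last dominant term on the closed disc of
  radius \<open>r\<close> has index \<open>d\<close>. If \<open>d > 0\<close> there is a zero in the disc (\<open>ex_zero_power_series\<close>), the limit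
  of suitable zeros of the polynomial truncations. Dividing by \<open>t - \<alpha>\<close> for a zero \<open>\<alpha>\<close> replaces
  \<open>d\<close> by \<open>d - 1\<close> (\<open>distinguished_difference_quotient\<close>). Induction on \<open>d\<close> then shows that the
  vanishing orders add up to \<open>d\<close> (\<open>sum_vanishing_order_disc_zeros\<close>), without a factorization into a
  polynomial and a unit. The same division by linear factors, iterated at a fixed point, yields the
  Taylor expansions in which the orders are measured.
\<close>

section \<open>Ultrametric fields\<close>

lemma absval_nonneg [simp]: "absval x \<ge> 0"
  for x :: "'a::ultrametric_field"
  by (metis diff_zero dist_absval zero_le_dist)

lemma absval_eq_0_iff [simp]: "absval x = 0 \<longleftrightarrow> x = 0"
  for x :: "'a::ultrametric_field"
  by (metis diff_zero dist_absval dist_eq_0_iff)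

lemma absval_0 [simp]: "absval (0 :: 'a::ultrametric_field) = 0"
  by simp

lemma absval_pos_iff [simp]: "absval x > 0 \<longleftrightarrow> x \<noteq> 0"
  for x :: "'a::ultrametric_field"
  by (metis absval_eq_0_iff absval_nonneg less_eq_real_def less_irrefl)

lemma absval_1 [simp]: "absval (1 :: 'a::ultrametric_field) = 1"
  by (metis absval_eq_0_iff absval_mult mult_cancel_left1 mult_1 zero_neq_one)

lemma absval_power: "absval (x ^ n) = absval x ^ n"
  for x :: "'a::ultrametric_field"
  by (induction n) (auto simp: absval_mult)

lemma absval_minus_commute: "absval (x - y) = absval (y - x)"
  for x :: "'a::ultrametric_field"
  by (metis dist_absval dist_commute)

lemma absval_minus [simp]: "absval (- x) = absval x"
  for x :: "'a::ultrametric_field"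
  using absval_minus_commute[of 0 x] by simp

lemma absval_divide: "absval (x / y) = absval x / absval y"
  for x :: "'a::ultrametric_field"
proof (cases "y = 0")
  case False
  then have "absval (x / y) * absval y = absval x"
    by (simp flip: absval_mult)
  with False show ?thesis
    by (simp add: field_simps)
qed simp

lemma absval_prod: "absval (prod f S) = (\<Prod>i\<in>S. absval (f i))"
  for f :: "'b \<Rightarrow> 'a::ultrametric_field"
  by (induction S rule: infinite_finite_induct) (auto simp: absval_mult)

lemma absval_diff_le_max: "absval (x - y) \<le> max (absval x) (absval y)"
  for x :: "'a::ultrametric_field"
  using absval_add_le_max[of x "- y"] by simp

lemma absval_add_le: "absval (x + y) \<le> absval x + absval y"
  for x :: "'a::ultrametric_field"
  using absval_add_le_max[of x y] absval_nonneg[of x] absval_nonneg[of y] by linarith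

lemma absval_add_eq_left:
  fixes x :: "'a::ultrametric_field"
  assumes "absval y < absval x"
  shows "absval (x + y) = absval x"
proof (rule antisym)
  show "absval (x + y) \<le> absval x"
    using absval_add_le_max[of x y] assms by linarith
  have "absval x \<le> max (absval (x + y)) (absval y)"
    using absval_diff_le_max[of "x + y" y] by simp
  then show "absval x \<le> absval (x + y)"
    using assms by linarith
qed

lemma absval_of_nat_le_1: "absval (of_nat n :: 'a::ultrametric_field) \<le> 1"
proof (induction n)
  case (Suc n)
  show ?case
    using absval_add_le_max[of 1 "of_nat n :: 'a"] Suc by simp
qed simp

lemma absval_sum_less:
  fixes f :: "'b \<Rightarrow> 'a::ultrametric_field"
  assumes "\<And>i. i \<in> S \<Longrightarrow> absval (f i) < B" "B > 0"
  shows "absval (sum f S) < B"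
  using assms
proof (induction S rule: infinite_finite_induct)
  case (insert i S)
  then have "absval (f i) < B" "absval (sum f S) < B"
    by auto
  then have "absval (f i + sum f S) < B"
    using absval_add_le_max[of "f i" "sum f S"] by linarith
  with insert(1,2) show ?case
    by simp
qed auto

lemma tendsto_absval_iff:
  fixes f :: "'b \<Rightarrow> 'a::ultrametric_field"
  shows "(f \<longlongrightarrow> l) F \<longleftrightarrow> ((\<lambda>x. absval (f x - l)) \<longlongrightarrow> 0) F"
  by (subst tendsto_dist_iff) (simp add: dist_absval)

text \<open>
  Continuity of addition and negation makes the general limit laws available for sums and
  differences of sequences and series.
\<close>

instance ultrametric_field \<subseteq> topological_ab_group_add
proof
  fix a b :: 'a
  show "LIM x (nhds a \<times>\<^sub>F nhds b). fst x + snd x :> nhds (a + b)"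
    unfolding tendsto_absval_iff
  proof (rule tendsto_sandwich[OF _ _ tendsto_const])
    let ?F = "nhds a \<times>\<^sub>F nhds b"
    have "(fst \<longlongrightarrow> a) ?F" "(snd \<longlongrightarrow> b) ?F"
      by (rule filterlim_fst filterlim_snd)+
    then show "((\<lambda>x. absval (fst x - a) + absval (snd x - b)) \<longlongrightarrow> 0) ?F"
      unfolding tendsto_absval_iff by (rule tendsto_add_zero)
    show "\<forall>\<^sub>F x in ?F. absval (fst x + snd x - (a + b)) \<le> absval (fst x - a) + absval (snd x - b)"
      by (intro always_eventually allI)
         (metis absval_add_le add_diff_add)
  qed simp
  show "(uminus \<longlongrightarrow> - a) (nhds a)"
  proof -
    have "absval (- x - - a) = absval (x - a)" for x
      using absval_minus[of "x - a"] by (simp del: absval_minus)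
    moreover have "((\<lambda>x. x) \<longlongrightarrow> a) (nhds a)"
      by (rule filterlim_ident)
    ultimately show ?thesis
      unfolding tendsto_absval_iff by (simp only:)
  qed
qed

lemma tendsto_mult_left_ultrametric:
  fixes f :: "'b \<Rightarrow> 'a::ultrametric_field"
  assumes "(f \<longlongrightarrow> l) F"
  shows "((\<lambda>x. c * f x) \<longlongrightarrow> c * l) F"
proof (rule iffD2[OF tendsto_absval_iff])
  have "((\<lambda>x. absval c * absval (f x - l)) \<longlongrightarrow> 0) F"
    by (rule tendsto_mult_right_zero[OF iffD1[OF tendsto_absval_iff assms]])
  then show "((\<lambda>x. absval (c * f x - c * l)) \<longlongrightarrow> 0) F"
    by (simp only: absval_mult right_diff_distrib[symmetric])
qed

section \<open>Series in complete ultrametric fields\<close>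

lemma sums_mult_ultrametric:
  fixes f :: "nat \<Rightarrow> 'a::ultrametric_field"
  assumes "f sums s"
  shows "(\<lambda>n. c * f n) sums (c * s)"
  using tendsto_mult_left_ultrametric[OF assms[unfolded sums_def], of c]
  by (simp add: sums_def sum_distrib_left)

lemma sums_diff_ultrametric:
  fixes f :: "nat \<Rightarrow> 'a::ultrametric_field"
  assumes "f sums s" "h sums s'"
  shows "(\<lambda>n. f n - h n) sums (s - s')"
  using assms unfolding sums_def sum_subtractf by (rule tendsto_diff)

lemma absval_tendsto_0_comparison:
  fixes f :: "'b \<Rightarrow> 'a::ultrametric_field"
  assumes "\<And>x. absval (f x) \<le> u x" "(u \<longlongrightarrow> 0) F"
  shows "((\<lambda>x. absval (f x)) \<longlongrightarrow> 0) F"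
  by (rule tendsto_sandwich[OF _ _ tendsto_const assms(2)]) (auto intro: always_eventually assms(1))

lemma summable_absval_tendsto_0:
  fixes f :: "nat \<Rightarrow> 'a::ultrametric_field"
  assumes "summable f"
  shows "(\<lambda>n. absval (f n)) \<longlonglongrightarrow> 0"
proof -
  have S: "(\<lambda>n. sum f {..<n}) \<longlonglongrightarrow> suminf f"
    using assms by (rule summable_LIMSEQ)
  have "(\<lambda>n. sum f {..<Suc n} - sum f {..<n}) \<longlonglongrightarrow> suminf f - suminf f"
    by (intro tendsto_diff S LIMSEQ_Suc)
  then show ?thesis
    unfolding tendsto_absval_iff by simp
qed

lemma summable_ultrametric:
  fixes f :: "nat \<Rightarrow> 'a::{ultrametric_field,complete_space}"
  assumes "(\<lambda>n. absval (f n)) \<longlonglongrightarrow> 0"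
  shows "summable f"
proof -
  have "Cauchy (\<lambda>n. sum f {..<n})"
    unfolding Cauchy_altdef2
  proof (intro allI impI)
    fix e :: real
    assume "e > 0"
    then obtain N where N: "\<And>n. n \<ge> N \<Longrightarrow> absval (f n) < e"
      using order_tendstoD(2)[OF assms, of e] by (auto simp: eventually_sequentially)
    show "\<exists>N. \<forall>n\<ge>N. dist (sum f {..<n}) (sum f {..<N}) < e"
    proof (intro exI allI impI)
      fix n assume "n \<ge> N"
      then have "sum f {..<n} - sum f {..<N} = sum f {N..<n}"
        by (simp add: sum_diff_nat_ivl lessThan_atLeast0)
      then show "dist (sum f {..<n}) (sum f {..<N}) < e"
        unfolding dist_absval using \<open>e > 0\<close> N by (auto intro: absval_sum_less)
    qed
  qed
  then show ?thesis
    by (simp add: Cauchy_convergent_iff summable_iff_convergent)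
qed

lemma sums_split_initial_segment_ultrametric:
  fixes f :: "nat \<Rightarrow> 'a::ultrametric_field"
  assumes "f sums s"
  shows "(\<lambda>n. f (n + N)) sums (s - sum f {..<N})"
proof -
  have "(\<lambda>n. sum f {..<n + N} - sum f {..<N}) \<longlonglongrightarrow> s - sum f {..<N}"
    using assms unfolding sums_def
    by (rule tendsto_diff[OF LIMSEQ_ignore_initial_segment tendsto_const])
  moreover have "sum f {..<n + N} - sum f {..<N} = (\<Sum>i<n. f (i + N))" for n
  proof (induction n)
    case (Suc n)
    then show ?case
      by (simp add: diff_eq_eq add.assoc)
  qed simp
  ultimately show ?thesis
    unfolding sums_def by simp
qed

text \<open>
  The sum is eventually within any distance of its partial sums, so it obeys the bound that holds
  for the finite sums; strictness survives because a single partial sum already suffices.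
\<close>

lemma absval_suminf_less:
  fixes f :: "nat \<Rightarrow> 'a::ultrametric_field"
  assumes "summable f" "\<And>n. absval (f n) < B"
  shows "absval (suminf f) < B"
proof -
  have B: "B > 0"
    using assms(2)[of 0] absval_nonneg[of "f 0"] by linarith
  have "(\<lambda>n. absval (sum f {..<n} - suminf f)) \<longlonglongrightarrow> 0"
    using summable_LIMSEQ[OF assms(1)] by (simp add: tendsto_absval_iff)
  then have "\<forall>\<^sub>F n in sequentially. absval (sum f {..<n} - suminf f) < B"
    using B by (rule order_tendstoD)
  then obtain n where "absval (sum f {..<n} - suminf f) < B"
    by (auto simp: eventually_sequentially)
  moreover have "absval (sum f {..<n}) < B"
    using assms(2) B by (intro absval_sum_less)
  ultimately show ?thesis
    using absval_diff_le_max[of "sum f {..<n}" "sum f {..<n} - suminf f"] by simp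
qed

lemma absval_suminf_le:
  fixes f :: "nat \<Rightarrow> 'a::ultrametric_field"
  assumes "summable f" "\<And>n. absval (f n) \<le> B"
  shows "absval (suminf f) \<le> B"
proof (rule dense_ge)
  fix C assume "B < C"
  then show "absval (suminf f) \<le> C"
    using absval_suminf_less[of f C] assms by (meson le_less_trans less_imp_le)
qed

lemma absval_suminf_dominant:
  fixes f :: "nat \<Rightarrow> 'a::ultrametric_field"
  assumes "summable f" "f d \<noteq> 0" "\<And>n. n \<noteq> d \<Longrightarrow> absval (f n) < absval (f d)"
  shows "absval (suminf f) = absval (f d)"
proof -
  let ?h = "\<lambda>n. f n - (if n = d then f n else 0)"
  have h: "summable ?h"
    using sums_diff_ultrametric[OF summable_sums[OF assms(1)] sums_single[of d f]] by (rule sums_summable)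
  have "suminf ?h = suminf f - f d"
    using sums_diff_ultrametric[OF summable_sums[OF assms(1)] sums_single[of d f]] by (simp add: sums_iff)
  moreover have "absval (suminf ?h) < absval (f d)"
    using assms by (intro absval_suminf_less[OF h]) auto
  ultimately show ?thesis
    using absval_add_eq_left[of "suminf ?h" "f d"] by simp
qed

section \<open>Power series on a closed disc\<close>

definition converges_on_disc :: "real \<Rightarrow> (nat \<Rightarrow> 'a::ultrametric_field) \<Rightarrow> bool" where
  "converges_on_disc r a \<longleftrightarrow> r > 0 \<and> (\<lambda>n. absval (a n) * r ^ n) \<longlonglongrightarrow> 0"

definition power_series :: "(nat \<Rightarrow> 'a::ultrametric_field) \<Rightarrow> 'a \<Rightarrow> 'a" where
  "power_series a t = (\<Sum>n. a n * t ^ n)"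

text \<open>
  The coefficients of the quotient \<open>(f(t) - f(\<alpha>)) / (t - \<alpha>)\<close>, where \<open>f\<close> is the series with
  coefficients \<open>a\<close>.
\<close>

definition difference_quotient ::
    "'a::ultrametric_field \<Rightarrow> (nat \<Rightarrow> 'a) \<Rightarrow> nat \<Rightarrow> 'a" where
  "difference_quotient \<alpha> a n = (\<Sum>k. a (Suc (n + k)) * \<alpha> ^ k)"

lemma absval_term_le:
  fixes t :: "'a::ultrametric_field"
  assumes "absval t \<le> r"
  shows "absval (c * t ^ n) \<le> absval c * r ^ n"
  using assms by (simp add: absval_mult absval_power mult_left_mono power_mono)

lemma bounded_on_disc:
  assumes "converges_on_disc r a"
  obtains B where "B > 0" "\<And>n. absval (a n) * r ^ n \<le> B"
proof -
  have "Bseq (\<lambda>n. absval (a n) * r ^ n)"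
    using assms convergentI convergent_imp_Bseq unfolding converges_on_disc_def by blast
  then obtain B where "B > 0" "\<And>n. norm (absval (a n) * r ^ n) \<le> B"
    by (rule BseqE) auto
  then show thesis
    by (intro that[of B]) (auto intro: order_trans[OF abs_ge_self])
qed

lemma power_series_sums:
  fixes a :: "nat \<Rightarrow> 'a::{ultrametric_field,complete_space}"
  assumes "converges_on_disc r a" "absval t \<le> r"
  shows "(\<lambda>n. a n * t ^ n) sums power_series a t"
proof -
  have "(\<lambda>n. absval (a n * t ^ n)) \<longlonglongrightarrow> 0"
    using assms(1) by (intro absval_tendsto_0_comparison[OF absval_term_le[OF assms(2)]])
      (simp add: converges_on_disc_def)
  then show ?thesis
    unfolding power_series_def by (intro summable_sums summable_ultrametric)
qed

lemma absval_power_series_le: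
  fixes a :: "nat \<Rightarrow> 'a::{ultrametric_field,complete_space}"
  assumes "converges_on_disc r a" "absval t \<le> r" "\<And>n. absval (a n) * r ^ n \<le> B"
  shows "absval (power_series a t) \<le> B"
  unfolding power_series_def
  by (intro absval_suminf_le sums_summable[OF power_series_sums[OF assms(1,2)]]
        order_trans[OF absval_term_le assms(3)] assms(2))

text \<open>
  Multiplying a term of the quotient by \<open>r ^ Suc n\<close> turns it into at most the corresponding term of
  the original series on the boundary of the disc.
\<close>

lemma absval_quotient_term_le:
  fixes \<alpha> :: "'a::ultrametric_field"
  assumes "absval \<alpha> \<le> r" "r > 0"
  shows "absval (a (Suc (n + k)) * \<alpha> ^ k) \<le> absval (a (Suc (n + k))) * r ^ Suc (n + k) / r ^ Suc n"
proof -
  have "r ^ Suc (n + k) / r ^ Suc n = r ^ k"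
    using assms by (simp add: power_add)
  then show ?thesis
    using absval_term_le[OF assms(1), of "a (Suc (n + k))" k] by (metis times_divide_eq_right)
qed

lemma difference_quotient_sums:
  fixes a :: "nat \<Rightarrow> 'a::{ultrametric_field,complete_space}"
  assumes "converges_on_disc r a" "absval \<alpha> \<le> r"
  shows "(\<lambda>k. a (Suc (n + k)) * \<alpha> ^ k) sums difference_quotient \<alpha> a n"
proof -
  have r: "r > 0" and lim: "(\<lambda>n. absval (a n) * r ^ n) \<longlonglongrightarrow> 0"
    using assms(1) by (auto simp: converges_on_disc_def)
  have "(\<lambda>k. absval (a (k + Suc n)) * r ^ (k + Suc n)) \<longlonglongrightarrow> 0"
    using lim by (rule LIMSEQ_ignore_initial_segment)
  from tendsto_divide[OF this tendsto_const[of "r ^ Suc n"]]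
  have "(\<lambda>k. absval (a (Suc (n + k))) * r ^ Suc (n + k) / r ^ Suc n) \<longlonglongrightarrow> 0"
    using r by (simp add: add.commute)
  then have "(\<lambda>k. absval (a (Suc (n + k)) * \<alpha> ^ k)) \<longlonglongrightarrow> 0"
    by (rule absval_tendsto_0_comparison[OF absval_quotient_term_le[OF assms(2) r]])
  then show ?thesis
    unfolding difference_quotient_def by (intro summable_sums summable_ultrametric)
qed

lemma difference_quotient_less:
  fixes a :: "nat \<Rightarrow> 'a::{ultrametric_field,complete_space}"
  assumes "converges_on_disc r a" "absval \<alpha> \<le> r" "\<And>m. m > n \<Longrightarrow> absval (a m) * r ^ m < B"
  shows "absval (difference_quotient \<alpha> a n) * r ^ Suc n < B"
proof -
  have r: "r > 0"
    using assms(1) by (auto simp: converges_on_disc_def)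
  have "absval (difference_quotient \<alpha> a n) < B / r ^ Suc n"
    unfolding difference_quotient_def
  proof (rule absval_suminf_less[OF sums_summable[OF difference_quotient_sums[OF assms(1,2)]]])
    fix k
    show "absval (a (Suc (n + k)) * \<alpha> ^ k) < B / r ^ Suc n"
      by (rule le_less_trans[OF absval_quotient_term_le[OF assms(2) r]])
         (intro divide_strict_right_mono assms(3), use r in auto)
  qed
  then show ?thesis
    using r by (simp add: pos_less_divide_eq)
qed

lemma difference_quotient_le:
  fixes a :: "nat \<Rightarrow> 'a::{ultrametric_field,complete_space}"
  assumes "converges_on_disc r a" "absval \<alpha> \<le> r" "\<And>m. m > n \<Longrightarrow> absval (a m) * r ^ m \<le> B"
  shows "absval (difference_quotient \<alpha> a n) * r ^ Suc n \<le> B"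
proof (rule dense_ge)
  fix C assume "B < C"
  then show "absval (difference_quotient \<alpha> a n) * r ^ Suc n \<le> C"
    using assms(3) by (intro less_imp_le difference_quotient_less[OF assms(1,2)]) (meson le_less_trans)
qed

lemma difference_quotient_bound:
  fixes a :: "nat \<Rightarrow> 'a::{ultrametric_field,complete_space}"
  assumes "converges_on_disc r a" "absval \<alpha> \<le> r" "\<And>m. absval (a m) * r ^ m \<le> B"
  shows "absval (difference_quotient \<alpha> a n) * r ^ n \<le> B / r"
  using difference_quotient_le[OF assms] assms(1)
  by (simp add: converges_on_disc_def field_simps)

lemma converges_on_disc_difference_quotient:
  fixes a :: "nat \<Rightarrow> 'a::{ultrametric_field,complete_space}"
  assumes "converges_on_disc r a" "absval \<alpha> \<le> r"
  shows "converges_on_disc r (difference_quotient \<alpha> a)"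
proof -
  have r: "r > 0" and lim: "(\<lambda>n. absval (a n) * r ^ n) \<longlonglongrightarrow> 0"
    using assms(1) by (auto simp: converges_on_disc_def)
  have "(\<lambda>n. absval (difference_quotient \<alpha> a n) * r ^ n) \<longlonglongrightarrow> 0"
  proof (rule LIMSEQ_I)
    fix e :: real
    assume "e > 0"
    then have "\<forall>\<^sub>F n in sequentially. absval (a n) * r ^ n < e * r"
      using r by (intro order_tendstoD(2)[OF lim]) auto
    then obtain N where N: "\<And>n. n \<ge> N \<Longrightarrow> absval (a n) * r ^ n < e * r"
      by (auto simp: eventually_sequentially)
    have "absval (difference_quotient \<alpha> a n) * r ^ n < e" if "n \<ge> N" for n
      using difference_quotient_less[OF assms, of n "e * r"] N that r by (simp add: mult_ac)
    then show "\<exists>N. \<forall>n\<ge>N. norm (absval (difference_quotient \<alpha> a n) * r ^ n - 0) < e"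
      using r by auto
  qed
  with r show ?thesis
    by (simp add: converges_on_disc_def)
qed

lemma coeff_eq_difference_quotient:
  fixes a :: "nat \<Rightarrow> 'a::{ultrametric_field,complete_space}"
  assumes "converges_on_disc r a" "absval \<alpha> \<le> r"
  shows "a (Suc n) = difference_quotient \<alpha> a n - \<alpha> * difference_quotient \<alpha> a (Suc n)"
proof -
  have "(\<lambda>k. \<alpha> * (a (Suc (Suc n + k)) * \<alpha> ^ k)) sums (\<alpha> * difference_quotient \<alpha> a (Suc n))"
    by (rule sums_mult_ultrametric[OF difference_quotient_sums[OF assms]])
  then have "(\<lambda>k. a (Suc (n + Suc k)) * \<alpha> ^ Suc k) sums (\<alpha> * difference_quotient \<alpha> a (Suc n))"
    by (simp add: mult_ac)
  from sums_Suc[OF this]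
  have "(\<lambda>k. a (Suc (n + k)) * \<alpha> ^ k) sums (\<alpha> * difference_quotient \<alpha> a (Suc n) + a (Suc n))"
    by simp
  from sums_unique2[OF this difference_quotient_sums[OF assms]] show ?thesis
    by (simp add: algebra_simps)
qed

text \<open>
  Each coefficient of \<open>f\<close> is a difference of consecutive quotient coefficients, so summing the
  series of \<open>f\<close> telescopes into \<open>(t - \<alpha>)\<close> times the quotient.
\<close>

lemma power_series_difference_quotient:
  fixes a :: "nat \<Rightarrow> 'a::{ultrametric_field,complete_space}"
  assumes "converges_on_disc r a" "absval \<alpha> \<le> r" "absval t \<le> r"
  shows "power_series a t =
    power_series a \<alpha> + (t - \<alpha>) * power_series (difference_quotient \<alpha> a) t"
proof -
  let ?b = "difference_quotient \<alpha> a"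
  have Suc_tail: "(\<lambda>n. ?b (Suc n) * t ^ Suc n) sums (power_series ?b t - ?b 0)"
    using sums_split_initial_segment_ultrametric
      [OF power_series_sums[OF converges_on_disc_difference_quotient[OF assms(1,2)] assms(3)], of 1]
    by simp
  have "(\<lambda>n. t * (?b n * t ^ n) - \<alpha> * (?b (Suc n) * t ^ Suc n)) sums
      (t * power_series ?b t - \<alpha> * (power_series ?b t - ?b 0))"
    by (intro sums_diff_ultrametric sums_mult_ultrametric Suc_tail power_series_sums[OF _ assms(3)]
          converges_on_disc_difference_quotient assms(1,2))
  moreover have "t * (?b n * t ^ n) - \<alpha> * (?b (Suc n) * t ^ Suc n) = a (Suc n) * t ^ Suc n" for n
    by (subst coeff_eq_difference_quotient[OF assms(1,2)]) (simp add: algebra_simps)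
  ultimately have "(\<lambda>n. a (Suc n) * t ^ Suc n) sums
      (t * power_series ?b t - \<alpha> * (power_series ?b t - ?b 0))"
    by simp
  from sums_Suc[OF this]
  have t: "power_series a t = t * power_series ?b t - \<alpha> * (power_series ?b t - ?b 0) + a 0"
    by (simp add: power_series_def sums_iff)
  have "(\<lambda>n. \<alpha> * (a (Suc (0 + n)) * \<alpha> ^ n)) sums (\<alpha> * ?b 0)"
    by (intro sums_mult_ultrametric difference_quotient_sums[OF assms(1,2)])
  then have "(\<lambda>n. a (Suc n) * \<alpha> ^ Suc n) sums (\<alpha> * ?b 0)"
    by (simp add: mult_ac)
  from sums_Suc[OF this] have "power_series a \<alpha> = \<alpha> * ?b 0 + a 0"
    by (simp add: power_series_def sums_iff)
  with t show ?thesis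
    by (simp add: algebra_simps)
qed

section \<open>Distinguished series\<close>

text \<open>
  The last dominant term on the circle of radius \<open>r\<close> is the one of index \<open>d\<close>. This \<open>d\<close> is the
  Weierstrass degree on the closed disc of radius \<open>r\<close>, which will turn out to be the number of
  zeros there.
\<close>

definition distinguished :: "real \<Rightarrow> (nat \<Rightarrow> 'a::ultrametric_field) \<Rightarrow> nat \<Rightarrow> bool" where
  "distinguished r a d \<longleftrightarrow> converges_on_disc r a \<and> a d \<noteq> 0 \<and>
     (\<forall>n. absval (a n) * r ^ n \<le> absval (a d) * r ^ d) \<and>
     (\<forall>n>d. absval (a n) * r ^ n < absval (a d) * r ^ d)"

lemma distinguishedD:
  assumes "distinguished r a d"
  shows "converges_on_disc r a" "a d \<noteq> 0" "r > 0"
    "absval (a n) * r ^ n \<le> absval (a d) * r ^ d"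
    "n > d \<Longrightarrow> absval (a n) * r ^ n < absval (a d) * r ^ d"
  using assms by (auto simp: distinguished_def converges_on_disc_def)

lemma absval_power_series_distinguished_0:
  fixes a :: "nat \<Rightarrow> 'a::{ultrametric_field,complete_space}"
  assumes "distinguished r a 0" "absval t \<le> r"
  shows "absval (power_series a t) = absval (a 0)"
proof -
  have "absval (a n * t ^ n) < absval (a 0 * t ^ 0)" if "n \<noteq> 0" for n
    using absval_term_le[OF assms(2), of "a n" n] distinguishedD(5)[OF assms(1), of n] that by simp
  then have "absval (power_series a t) = absval (a 0 * t ^ 0)"
    unfolding power_series_def
    by (intro absval_suminf_dominant sums_summable[OF power_series_sums[OF _ assms(2)]])
       (use distinguishedD[OF assms(1)] in auto)
  then show ?thesis
    by simp
qed

text \<open>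
  Dividing by a linear factor with root in the disc lowers the Weierstrass degree by one: from
  index \<open>d\<close> on the quotient involves only the terms after \<open>Suc d\<close>, which are strictly smaller than
  the dominant one, except that the coefficient at \<open>d\<close> also contains \<open>a (Suc d)\<close> itself.
\<close>

lemma distinguished_difference_quotient:
  fixes a :: "nat \<Rightarrow> 'a::{ultrametric_field,complete_space}"
  assumes "distinguished r a (Suc d)" "absval \<alpha> \<le> r"
  shows "distinguished r (difference_quotient \<alpha> a) d"
    and "absval (difference_quotient \<alpha> a d) = absval (a (Suc d))"
proof -
  note a = distinguishedD[OF assms(1)]
  let ?b = "difference_quotient \<alpha> a"
  let ?B = "absval (a (Suc d)) * r ^ Suc d"
  have small: "absval (?b n) * r ^ Suc n < ?B" if "n > d" for n
    using that a(5) by (intro difference_quotient_less[OF a(1) assms(2)]) auto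
  have bound: "absval (?b n) * r ^ Suc n \<le> ?B" for n
    using a(4) by (intro difference_quotient_le[OF a(1) assms(2)])
  have "absval (\<alpha> * ?b (Suc d)) * r ^ Suc d \<le> absval (?b (Suc d)) * r ^ Suc (Suc d)"
    using assms(2) a(3) by (simp add: absval_mult mult_ac) (simp add: mult_right_mono flip: mult.assoc)
  also have "\<dots> < ?B"
    by (rule small) simp
  finally have "absval (\<alpha> * ?b (Suc d)) < absval (a (Suc d))"
    using a(3) by simp
  moreover have "?b d = a (Suc d) + \<alpha> * ?b (Suc d)"
    using coeff_eq_difference_quotient[OF a(1) assms(2), of d] by (simp add: algebra_simps)
  ultimately show lead: "absval (?b d) = absval (a (Suc d))"
    by (simp add: absval_add_eq_left)
  show "distinguished r ?b d"
    unfolding distinguished_def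
  proof (intro conjI allI impI)
    show "converges_on_disc r ?b"
      by (intro converges_on_disc_difference_quotient a(1) assms(2))
    show "?b d \<noteq> 0"
      using lead a(2) by (metis absval_eq_0_iff)
    show "absval (?b n) * r ^ n \<le> absval (?b d) * r ^ d" for n
      using bound[of n] a(3) by (simp add: lead mult_ac)
    show "absval (?b n) * r ^ n < absval (?b d) * r ^ d" if "n > d" for n
      using small[OF that] a(3) by (simp add: lead mult_ac)
  qed
qed

section \<open>Existence of zeros\<close>

text \<open>
  A polynomial splits into linear factors. If all its roots lie outside the disc then each factor
  \<open>X - \<beta>\<close> has a strictly dominant constant term on the boundary, and this property is preserved
  by products.
\<close>

lemma constant_term_dominant_if_no_root:
  fixes P :: "'a::{ultrametric_field,alg_closed_field} poly"
  assumes "\<And>t. absval t \<le> r \<Longrightarrow> poly P t \<noteq> 0" "r > 0" "n > 0"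
  shows "absval (coeff P n) * r ^ n < absval (coeff P 0)"
  using assms(1,3)
proof (induction "degree P" arbitrary: P n)
  case 0
  then show ?case
    using 0(2)[of 0] assms(2) by (simp add: poly_0_coeff_0 coeff_eq_0)
next
  case (Suc d)
  then obtain \<beta> where "poly P \<beta> = 0"
    using alg_closed_imp_poly_has_root[of P] by auto
  then obtain Q where P: "P = [:- \<beta>, 1:] * Q"
    by (metis dvdE poly_eq_0_iff_dvd)
  have \<beta>: "absval \<beta> > r"
    using \<open>poly P \<beta> = 0\<close> Suc.prems(1) not_less by blast
  have "Q \<noteq> 0"
    using Suc.hyps(2) P by auto
  then have "degree P = Suc (degree Q)"
    unfolding P by (subst degree_mult_eq) auto
  then have "d = degree Q"
    using Suc.hyps(2) by simp
  have no_root: "poly Q t \<noteq> 0" if "absval t \<le> r" for t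
    using Suc.prems(1)[OF that] P by auto
  have Q: "absval (coeff Q k) * r ^ k < absval (coeff Q 0)" if "k > 0" for k
    using Suc.hyps(1)[of Q k] \<open>d = degree Q\<close> no_root that by blast
  obtain m where m: "n = Suc m"
    using Suc.prems(2) gr0_implies_Suc by blast
  have Q0: "absval (coeff Q 0) > 0"
    using no_root[of 0] assms(2) by (simp add: poly_0_coeff_0)
  have Qm: "absval (coeff Q m) * r ^ m \<le> absval (coeff Q 0)"
    using Q[of m] by (cases "m = 0") auto
  have "absval (coeff Q m) * r ^ n \<le> absval (coeff Q 0) * r"
    using mult_right_mono[OF Qm, of r] assms(2) by (simp add: m mult_ac)
  also have "\<dots> < absval (coeff Q 0) * absval \<beta>"
    using \<beta> Q0 by simp
  finally have 1: "absval (coeff Q m) * r ^ n < absval (coeff Q 0) * absval \<beta>" .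
  have 2: "absval (- \<beta> * coeff Q n) * r ^ n < absval (coeff Q 0) * absval \<beta>"
    using mult_strict_left_mono[OF Q[OF Suc.prems(2)], of "absval \<beta>"] le_less_trans[OF _ \<beta>, of 0]
      assms(2)
    by (simp add: absval_mult mult_ac)
  have "coeff P n = - \<beta> * coeff Q n + coeff Q m"
    by (simp add: P m)
  then have "absval (coeff P n) \<le> absval (- \<beta> * coeff Q n) \<or> absval (coeff P n) \<le> absval (coeff Q m)"
    using absval_add_le_max[of "- \<beta> * coeff Q n" "coeff Q m"] by (metis le_max_iff_disj)
  then have "absval (coeff P n) * r ^ n \<le> absval (- \<beta> * coeff Q n) * r ^ n \<or>
      absval (coeff P n) * r ^ n \<le> absval (coeff Q m) * r ^ n"
    using assms(2) by (meson less_imp_le mult_right_mono zero_less_power)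
  then have "absval (coeff P n) * r ^ n < absval (coeff Q 0) * absval \<beta>"
    using 1 2 by linarith
  also have "\<dots> = absval (coeff P 0)"
    by (simp add: P absval_mult)
  finally show ?case .
qed

lemma ex_zero_polynomial:
  fixes a :: "nat \<Rightarrow> 'a::{ultrametric_field,alg_closed_field}"
  assumes "distinguished r a d" "d > 0" "\<And>n. n > N \<Longrightarrow> a n = 0"
  obtains \<alpha> where "absval \<alpha> \<le> r" "power_series a \<alpha> = 0"
proof -
  define P where "P = Abs_poly a"
  have coeff: "coeff P = a"
    unfolding P_def using assms(3) by (intro ext coeff_Abs_poly)
  have "poly P t = power_series a t" for t
  proof -
    have "poly P t = (\<Sum>n\<le>degree P. a n * t ^ n)"
      by (simp add: poly_altdef coeff)
    also have "\<dots> = power_series a t"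
      unfolding power_series_def
      by (rule suminf_finite[symmetric]) (auto simp: coeff_eq_0 not_le simp flip: coeff)
    finally show ?thesis .
  qed
  moreover have "\<exists>\<alpha>. absval \<alpha> \<le> r \<and> poly P \<alpha> = 0"
  proof (rule ccontr)
    assume "\<nexists>\<alpha>. absval \<alpha> \<le> r \<and> poly P \<alpha> = 0"
    then have "absval (a d) * r ^ d < absval (a 0)"
      using constant_term_dominant_if_no_root[of r P d] assms(2) distinguishedD(3)[OF assms(1)]
      by (auto simp: coeff)
    then show False
      using distinguishedD(4)[OF assms(1), of 0] by simp
  qed
  ultimately show thesis
    using that by auto
qed

text \<open>
  The absolute value at \<open>t\<close> is \<open>absval (a (Suc d))\<close> times the product of the distances from \<open>t\<close> to
  the \<open>Suc d\<close> roots in the disc, so a root nearest to \<open>t\<close> is this close.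
\<close>

lemma ex_near_zero_polynomial:
  fixes a :: "nat \<Rightarrow> 'a::complete_alg_closed_ultrametric_field"
  assumes "distinguished r a (Suc d)" "\<And>n. n > N \<Longrightarrow> a n = 0" "absval t \<le> r"
  shows "\<exists>\<beta>. absval \<beta> \<le> r \<and> power_series a \<beta> = 0 \<and>
    absval (t - \<beta>) ^ Suc d * absval (a (Suc d)) \<le> absval (power_series a t)"
  using assms(1,2)
proof (induction d arbitrary: a)
  case (0 a)
  obtain \<alpha> where \<alpha>: "absval \<alpha> \<le> r" "power_series a \<alpha> = 0"
    using ex_zero_polynomial[OF 0(1) _ 0(2)] by auto
  have "power_series a t = (t - \<alpha>) * power_series (difference_quotient \<alpha> a) t"
    using power_series_difference_quotient[OF distinguishedD(1)[OF 0(1)] \<alpha>(1) assms(3)] \<alpha>(2) by simp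
  then have "absval (power_series a t) = absval (t - \<alpha>) * absval (a (Suc 0))"
    using absval_power_series_distinguished_0
        [OF distinguished_difference_quotient(1)[OF 0(1) \<alpha>(1)] assms(3)]
      distinguished_difference_quotient(2)[OF 0(1) \<alpha>(1)]
    by (simp add: absval_mult)
  with \<alpha> show ?case
    by auto
next
  case (Suc d a)
  obtain \<alpha> where \<alpha>: "absval \<alpha> \<le> r" "power_series a \<alpha> = 0"
    using ex_zero_polynomial[OF Suc.prems(1) _ Suc.prems(2)] by auto
  let ?b = "difference_quotient \<alpha> a"
  have factor: "power_series a s = (s - \<alpha>) * power_series ?b s" if "absval s \<le> r" for s
    using power_series_difference_quotient[OF distinguishedD(1)[OF Suc.prems(1)] \<alpha>(1) that] \<alpha>(2)
    by simp
  note b = distinguished_difference_quotient[OF Suc.prems(1) \<alpha>(1)]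
  have "?b n = 0" if "n > N" for n
    unfolding difference_quotient_def using Suc.prems(2) that by simp
  from Suc.IH[OF b(1) this] obtain \<beta> where \<beta>: "absval \<beta> \<le> r" "power_series ?b \<beta> = 0"
    "absval (t - \<beta>) ^ Suc d * absval (a (Suc (Suc d))) \<le> absval (power_series ?b t)"
    using b(2) by auto
  have prod: "absval (t - \<alpha>) * (absval (t - \<beta>) ^ Suc d * absval (a (Suc (Suc d))))
      \<le> absval (power_series a t)"
    unfolding factor[OF assms(3)] absval_mult by (rule mult_left_mono[OF \<beta>(3)]) simp
  show ?case
  proof (cases "absval (t - \<alpha>) \<le> absval (t - \<beta>)")
    case True
    have "absval (t - \<alpha>) ^ Suc (Suc d) * absval (a (Suc (Suc d))) =
        absval (t - \<alpha>) * (absval (t - \<alpha>) ^ Suc d * absval (a (Suc (Suc d))))"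
      by simp
    also have "\<dots> \<le> absval (t - \<alpha>) * (absval (t - \<beta>) ^ Suc d * absval (a (Suc (Suc d))))"
      by (intro mult_left_mono mult_right_mono power_mono True) auto
    finally show ?thesis
      using prod \<alpha> by (intro exI[of _ \<alpha>] conjI) auto
  next
    case False
    have "absval (t - \<beta>) ^ Suc (Suc d) * absval (a (Suc (Suc d))) =
        absval (t - \<beta>) * (absval (t - \<beta>) ^ Suc d * absval (a (Suc (Suc d))))"
      by simp
    also have "\<dots> \<le> absval (t - \<alpha>) * (absval (t - \<beta>) ^ Suc d * absval (a (Suc (Suc d))))"
      using False by (intro mult_right_mono) auto
    finally show ?thesis
      using prod \<beta>(1,2) factor[OF \<beta>(1)] by (intro exI[of _ \<beta>] conjI) auto
  qed
qed

definition truncate :: "nat \<Rightarrow> (nat \<Rightarrow> 'a::zero) \<Rightarrow> nat \<Rightarrow> 'a" where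
  "truncate N a n = (if n \<le> N then a n else 0)"

lemma power_series_truncate:
  "power_series (truncate N a) t = (\<Sum>n<Suc N. a n * t ^ n)"
  for a :: "nat \<Rightarrow> 'a::ultrametric_field"
proof -
  have "power_series (truncate N a) t = (\<Sum>n<Suc N. truncate N a n * t ^ n)"
    unfolding power_series_def by (rule suminf_finite) (auto simp: truncate_def)
  also have "\<dots> = (\<Sum>n<Suc N. a n * t ^ n)"
    by (rule sum.cong) (auto simp: truncate_def)
  finally show ?thesis .
qed

lemma distinguished_truncate:
  assumes "distinguished r a d" "d \<le> N"
  shows "distinguished r (truncate N a) d"
proof -
  note a = distinguishedD[OF assms(1)]
  have "(\<lambda>n. absval (truncate N a n) * r ^ n) \<longlonglongrightarrow> 0"
    by (rule tendsto_eventually) (auto simp: truncate_def eventually_sequentially intro!: exI[of _ "Suc N"])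
  moreover have "0 < absval (a d) * r ^ d"
    using a(2,3) by simp
  ultimately show ?thesis
    using a assms(2) by (auto simp: distinguished_def converges_on_disc_def truncate_def)
qed

text \<open>
  By the ultrametric inequality the telescoping series of the steps converges as soon as its terms
  tend to \<open>0\<close>.
\<close>

lemma convergent_if_steps_tendsto_0:
  fixes s :: "nat \<Rightarrow> 'a::{ultrametric_field,complete_space}"
  assumes "(\<lambda>n. absval (s (Suc n) - s n)) \<longlonglongrightarrow> 0"
  obtains L where "(\<lambda>n. absval (s n - L)) \<longlonglongrightarrow> 0"
proof -
  have "(\<lambda>n. \<Sum>i<n. s (Suc i) - s i) \<longlonglongrightarrow> (\<Sum>i. s (Suc i) - s i)"
    by (rule summable_LIMSEQ[OF summable_ultrametric[OF assms]])
  then have "(\<lambda>n. absval (s n - s 0 - (\<Sum>i. s (Suc i) - s i))) \<longlonglongrightarrow> 0"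
    unfolding tendsto_absval_iff sum_lessThan_telescope .
  then show thesis
    by (intro that[of "s 0 + (\<Sum>i. s (Suc i) - s i)"]) (simp add: diff_diff_eq)
qed

text \<open>
  Start from a root of a truncation and pass repeatedly to a nearest root of the next longer
  truncation. At the old root the longer truncation only has the value of its last term, which
  tends to \<open>0\<close>, so the steps tend to \<open>0\<close> and the roots converge to a zero of the series.
\<close>

theorem ex_zero_power_series:
  fixes a :: "nat \<Rightarrow> 'a::complete_alg_closed_ultrametric_field"
  assumes "distinguished r a (Suc d)"
  obtains \<alpha> where "absval \<alpha> \<le> r" "power_series a \<alpha> = 0"
proof -
  note a = distinguishedD[OF assms]
  have lim: "(\<lambda>n. absval (a n) * r ^ n) \<longlonglongrightarrow> 0"
    using a(1) by (simp add: converges_on_disc_def)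
  \<comment> \<open>The truncations start at the distinguished index, since shorter ones may have no zero in the disc.\<close>
  define T where "T n = truncate (n + Suc d) a" for n
  have T: "distinguished r (T n) (Suc d)" for n
    unfolding T_def by (intro distinguished_truncate assms) simp
  have T_fin: "T n m = 0" if "m > n + Suc d" for m n
    using that by (simp add: T_def truncate_def)
  have T_Suc: "power_series (T (Suc n)) t = power_series (T n) t + a (Suc (n + Suc d)) * t ^ Suc (n + Suc d)"
    for n t
    unfolding T_def power_series_truncate by simp
  have "\<exists>s. \<forall>n. (absval (s n) \<le> r \<and> power_series (T n) (s n) = 0) \<and>
      absval (s n - s (Suc n)) ^ Suc d * absval (a (Suc d)) \<le> absval (power_series (T (Suc n)) (s n))"
  proof (rule dependent_nat_choice)
    show "\<exists>x. absval x \<le> r \<and> power_series (T 0) x = 0"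
      by (rule ex_zero_polynomial[of r "T 0" "Suc d" "0 + Suc d"]) (use T T_fin in auto)
    fix x n
    assume "absval x \<le> r \<and> power_series (T n) x = 0"
    moreover have "T n (Suc d) = a (Suc d)" for n
      by (simp add: T_def truncate_def)
    ultimately show "\<exists>y. (absval y \<le> r \<and> power_series (T (Suc n)) y = 0) \<and>
        absval (x - y) ^ Suc d * absval (a (Suc d)) \<le> absval (power_series (T (Suc n)) x)"
      using ex_near_zero_polynomial[of r "T (Suc n)" d "Suc n + Suc d" x] T T_fin by auto
  qed
  then obtain s where s: "\<And>n. absval (s n) \<le> r" "\<And>n. power_series (T n) (s n) = 0"
    and near: "\<And>n. absval (s n - s (Suc n)) ^ Suc d * absval (a (Suc d))
      \<le> absval (power_series (T (Suc n)) (s n))"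
    by auto
  have tail: "(\<lambda>n. absval (a (n + Suc (Suc d))) * r ^ (n + Suc (Suc d))) \<longlonglongrightarrow> 0"
    by (rule LIMSEQ_ignore_initial_segment[OF lim])
  have "(\<lambda>n. absval (s (Suc n) - s n)) \<longlonglongrightarrow> 0"
  proof (rule LIMSEQ_I)
    fix e :: real
    assume e: "e > 0"
    then have "e ^ Suc d * absval (a (Suc d)) > 0"
      using a(2) by simp
    from order_tendstoD(2)[OF tail this] obtain N where
      N: "\<And>n. n \<ge> N \<Longrightarrow> absval (a (n + Suc (Suc d))) * r ^ (n + Suc (Suc d)) < e ^ Suc d * absval (a (Suc d))"
      by (auto simp: eventually_sequentially)
    have "absval (s (Suc n) - s n) < e" if "n \<ge> N" for n
    proof -
      have "absval (s n - s (Suc n)) ^ Suc d * absval (a (Suc d))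
          \<le> absval (a (n + Suc (Suc d)) * s n ^ (n + Suc (Suc d)))"
        using near[of n] unfolding T_Suc s(2) by simp
      also have "\<dots> \<le> absval (a (n + Suc (Suc d))) * r ^ (n + Suc (Suc d))"
        by (rule absval_term_le[OF s(1)])
      also have "\<dots> < e ^ Suc d * absval (a (Suc d))"
        by (rule N[OF that])
      finally have "absval (s n - s (Suc n)) ^ Suc d < e ^ Suc d"
        using mult_less_cancel_right_pos[of "absval (a (Suc d))"] a(2) by simp
      then show ?thesis
        using power_less_imp_less_base e by (metis absval_minus_commute less_imp_le)
    qed
    then show "\<exists>N. \<forall>n\<ge>N. norm (absval (s (Suc n) - s n) - 0) < e"
      by auto
  qed
  then obtain L where L: "(\<lambda>n. absval (s n - L)) \<longlonglongrightarrow> 0"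
    by (rule convergent_if_steps_tendsto_0)
  have "absval L \<le> r"
  proof -
    have "\<forall>\<^sub>F n in sequentially. absval (s n - L) < r"
      by (rule order_tendstoD(2)[OF L a(3)])
    then obtain n where "absval (s n - L) < r"
      by (auto simp: eventually_sequentially)
    then show ?thesis
      using absval_diff_le_max[of "s n" "s n - L"] s(1)[of n] by simp
  qed
  obtain B where B: "B > 0" "\<And>n. absval (a n) * r ^ n \<le> B"
    using bounded_on_disc[OF a(1)] by blast
  have value_lim: "(\<lambda>n. absval (power_series a (s n))) \<longlonglongrightarrow> 0"
  proof (rule LIMSEQ_I)
    fix e :: real
    assume "e > 0"
    from order_tendstoD(2)[OF lim this] obtain N where N: "\<And>n. n \<ge> N \<Longrightarrow> absval (a n) * r ^ n < e"
      by (auto simp: eventually_sequentially)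
    have "absval (power_series a (s n)) < e" if "n \<ge> N" for n
    proof -
      have "(\<lambda>k. a (k + Suc (n + Suc d)) * s n ^ (k + Suc (n + Suc d))) sums
          (power_series a (s n) - power_series (T n) (s n))"
        unfolding T_def power_series_truncate
        by (rule sums_split_initial_segment_ultrametric[OF power_series_sums[OF a(1) s(1)]])
      then have sums: "(\<lambda>k. a (k + Suc (n + Suc d)) * s n ^ (k + Suc (n + Suc d))) sums
          power_series a (s n)"
        by (simp add: s(2))
      show ?thesis
        unfolding sums_unique[OF sums]
      proof (rule absval_suminf_less[OF sums_summable[OF sums]])
        fix k
        show "absval (a (k + Suc (n + Suc d)) * s n ^ (k + Suc (n + Suc d))) < e"
          by (rule le_less_trans[OF absval_term_le[OF s(1)] N]) (use that in simp)
      qed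
    qed
    then show "\<exists>N. \<forall>n\<ge>N. norm (absval (power_series a (s n)) - 0) < e"
      by auto
  qed
  have bound: "absval (power_series a L) \<le> absval (power_series a (s n)) + absval (s n - L) * (B / r)" for n
  proof -
    have "absval (power_series (difference_quotient (s n) a) L) \<le> B / r"
      by (rule absval_power_series_le[OF converges_on_disc_difference_quotient[OF a(1) s(1)]
            \<open>absval L \<le> r\<close> difference_quotient_bound[OF a(1) s(1) B(2)]])
    then have "absval ((L - s n) * power_series (difference_quotient (s n) a) L)
        \<le> absval (s n - L) * (B / r)"
      unfolding absval_mult absval_minus_commute[of L] by (rule mult_left_mono) simp
    then show ?thesis
      using power_series_difference_quotient[OF a(1) s(1) \<open>absval L \<le> r\<close>, of n]
        absval_add_le[of "power_series a (s n)"
          "(L - s n) * power_series (difference_quotient (s n) a) L"]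
      by simp
  qed
  have "(\<lambda>n. absval (power_series a (s n)) + absval (s n - L) * (B / r)) \<longlonglongrightarrow> 0"
    by (rule tendsto_add_zero[OF value_lim tendsto_mult_left_zero[OF L]])
  then have "absval (power_series a L) \<le> 0"
    by (rule LIMSEQ_le_const) (use bound in auto)
  then have "power_series a L = 0"
    using absval_nonneg[of "power_series a L"] by (metis absval_eq_0_iff order_antisym)
  with \<open>absval L \<le> r\<close> show thesis
    by (rule that)
qed

section \<open>Expansions and vanishing orders\<close>

text \<open>
  At a point close enough to the centre the first nonzero term strictly dominates all later ones,
  so the sum cannot vanish there. Small nonzero points exist because the absolute value is not
  trivial, which is what the element \<open>\<pi>\<close> expresses.
\<close>

lemma fps_eq_0_if_sums_0:
  fixes F :: "'a::ultrametric_field fps"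
  assumes "\<pi> \<noteq> (0::'a)" "absval \<pi> < 1"
    and "r > 0" "\<And>s. absval s < r \<Longrightarrow> (\<lambda>k. fps_nth F k * s ^ k) sums 0"
  shows "F = 0"
proof (rule ccontr)
  assume "F \<noteq> 0"
  define m where "m = subdegree F"
  have Fm: "fps_nth F m \<noteq> 0"
    using \<open>F \<noteq> 0\<close> by (simp add: m_def)
  obtain j where "absval \<pi> ^ j < r"
    using real_arch_pow_inv[OF assms(3,2)] by blast
  define s\<^sub>0 where "s\<^sub>0 = \<pi> ^ j"
  have s\<^sub>0: "s\<^sub>0 \<noteq> 0" "absval s\<^sub>0 < r"
    using assms(1) \<open>absval \<pi> ^ j < r\<close> by (auto simp: s\<^sub>0_def absval_power)
  have "(\<lambda>k. absval (fps_nth F k * s\<^sub>0 ^ k)) \<longlonglongrightarrow> 0"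
    by (intro summable_absval_tendsto_0 sums_summable[OF assms(4)] s\<^sub>0(2))
  then have "Bseq (\<lambda>k. absval (fps_nth F k * s\<^sub>0 ^ k))"
    using convergentI convergent_imp_Bseq by blast
  then obtain B where "B > 0" and B: "\<And>k. absval (fps_nth F k * s\<^sub>0 ^ k) \<le> B"
    by (rule BseqE) auto
  define c where "c = absval (fps_nth F m * s\<^sub>0 ^ m)"
  have "c > 0"
    using Fm s\<^sub>0(1) by (simp add: c_def)
  then obtain i where i: "absval \<pi> ^ i < c / B"
    using real_arch_pow_inv[OF _ assms(2), of "c / B"] \<open>B > 0\<close> by auto
  define e where "e = absval \<pi> ^ i"
  have e: "e > 0" "e \<le> 1" "B * e < c"
    using assms(1,2) i \<open>B > 0\<close> by (auto simp: e_def power_le_one field_simps)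
  define s where "s = s\<^sub>0 * \<pi> ^ i"
  have scaled: "absval (fps_nth F k * s ^ k) = absval (fps_nth F k * s\<^sub>0 ^ k) * e ^ k" for k
    by (simp add: s_def e_def absval_mult absval_power power_mult_distrib)
  have "absval s \<le> absval s\<^sub>0"
    using mult_left_mono[OF e(2), of "absval s\<^sub>0"] by (simp add: s_def e_def absval_mult absval_power)
  with s\<^sub>0(2) have sums: "(\<lambda>k. fps_nth F k * s ^ k) sums 0"
    by (intro assms(4)) simp
  have "absval (\<Sum>k. fps_nth F k * s ^ k) = absval (fps_nth F m * s ^ m)"
  proof (rule absval_suminf_dominant[OF sums_summable[OF sums]])
    show "fps_nth F m * s ^ m \<noteq> 0"
      using Fm s\<^sub>0(1) assms(1) by (simp add: s_def)
    fix k
    assume "k \<noteq> m"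
    then consider "k < m" | "k > m"
      by linarith
    then show "absval (fps_nth F k * s ^ k) < absval (fps_nth F m * s ^ m)"
    proof cases
      case 1
      then have "fps_nth F k = 0"
        unfolding m_def by (rule nth_less_subdegree_zero)
      with \<open>c > 0\<close> e(1) show ?thesis
        unfolding scaled c_def[symmetric] by simp
    next
      case 2
      then have "e ^ k \<le> e ^ Suc m"
        using e by (intro power_decreasing) auto
      then have "absval (fps_nth F k * s\<^sub>0 ^ k) * e ^ k \<le> B * e ^ Suc m"
        using B[of k] e(1) \<open>B > 0\<close> by (intro mult_mono) auto
      also have "\<dots> = (B * e) * e ^ m"
        by simp
      also have "\<dots> < c * e ^ m"
        using e by simp
      finally show ?thesis
        unfolding scaled c_def .
    qed
  qed
  moreover have "(\<Sum>k. fps_nth F k * s ^ k) = 0"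
    using sums by (simp add: sums_iff)
  ultimately show False
    using Fm s\<^sub>0(1) assms(1) by (simp add: s_def)
qed

lemma has_expansion_at_unique:
  fixes f :: "'a::ultrametric_field \<Rightarrow> 'a"
  assumes "\<pi> \<noteq> (0::'a)" "absval \<pi> < 1"
    and "has_expansion_at f q F" "has_expansion_at f q G"
  shows "F = G"
proof -
  obtain r where r: "r > 0" "\<And>Q. Q \<in> ball q r \<Longrightarrow> (\<lambda>k. fps_nth F k * (Q - q) ^ k) sums f Q"
    using assms(3) by (auto simp: has_expansion_at_def)
  obtain r' where r': "r' > 0" "\<And>Q. Q \<in> ball q r' \<Longrightarrow> (\<lambda>k. fps_nth G k * (Q - q) ^ k) sums f Q"
    using assms(4) by (auto simp: has_expansion_at_def)
  have "F - G = 0"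
  proof (rule fps_eq_0_if_sums_0[OF assms(1,2)])
    show "min r r' > 0"
      using r r' by simp
    fix s :: 'a
    assume "absval s < min r r'"
    then have "q + s \<in> ball q r" "q + s \<in> ball q r'"
      by (auto simp: dist_absval)
    then show "(\<lambda>k. fps_nth (F - G) k * s ^ k) sums 0"
      using sums_diff_ultrametric[OF r(2) r'(2), of "q + s" "q + s"] by (simp add: left_diff_distrib)
  qed
  then show ?thesis
    by simp
qed

lemma vanishing_order_eq_subdegree:
  fixes f :: "'a::ultrametric_field \<Rightarrow> 'a"
  assumes "\<pi> \<noteq> (0::'a)" "absval \<pi> < 1" "has_expansion_at f q F"
  shows "vanishing_order f q = subdegree F"
  unfolding vanishing_order_def
  using the_equality[of "has_expansion_at f q" F] has_expansion_at_unique[OF assms(1,2)] assms(3)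
  by metis

lemma has_expansion_at_value:
  assumes "has_expansion_at f q F"
  shows "f q = fps_nth F 0"
proof -
  obtain r where "r > 0" "\<And>Q. Q \<in> ball q r \<Longrightarrow> (\<lambda>k. fps_nth F k * (Q - q) ^ k) sums f Q"
    using assms by (auto simp: has_expansion_at_def)
  then have "(\<lambda>k. fps_nth F k * (q - q) ^ k) sums f q"
    using centre_in_ball by blast
  moreover have "(\<lambda>k. fps_nth F k * (q - q) ^ k) = (\<lambda>k. if k = 0 then fps_nth F k else 0)"
    by (auto simp: fun_eq_iff)
  ultimately show ?thesis
    using sums_single[of 0 "fps_nth F"] sums_unique2 by metis
qed

lemma has_expansion_at_translate:
  fixes f :: "'a::ultrametric_field \<Rightarrow> 'a"
  assumes "has_expansion_at f (q - c) F"
  shows "has_expansion_at (\<lambda>Q. f (Q - c)) q F"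
proof -
  obtain r where "r > 0"
    and r: "\<And>Q. Q \<in> ball (q - c) r \<Longrightarrow> (\<lambda>k. fps_nth F k * (Q - (q - c)) ^ k) sums f Q"
    using assms by (auto simp: has_expansion_at_def)
  have "(\<lambda>k. fps_nth F k * (Q - q) ^ k) sums f (Q - c)" if "Q \<in> ball q r" for Q
    using r[of "Q - c"] that by (simp add: dist_absval)
  with \<open>r > 0\<close> show ?thesis
    unfolding has_expansion_at_def by blast
qed

lemma has_expansion_at_linear_factor:
  fixes f h :: "'a::ultrametric_field \<Rightarrow> 'a"
  assumes "has_expansion_at h \<beta> H" "r > 0" "\<And>t. t \<in> ball \<beta> r \<Longrightarrow> f t = (t - \<alpha>) * h t"
  shows "has_expansion_at f \<beta> ((fps_const (\<beta> - \<alpha>) + fps_X) * H)"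
proof -
  let ?F = "(fps_const (\<beta> - \<alpha>) + fps_X) * H"
  obtain r' where "r' > 0"
    and r': "\<And>t. t \<in> ball \<beta> r' \<Longrightarrow> (\<lambda>k. fps_nth H k * (t - \<beta>) ^ k) sums h t"
    using assms(1) by (auto simp: has_expansion_at_def)
  have "(\<lambda>k. fps_nth ?F k * (t - \<beta>) ^ k) sums f t" if "t \<in> ball \<beta> (min r r')" for t
  proof -
    let ?e = "\<lambda>k. (if k = 0 then 0 else fps_nth H (k - 1)) * (t - \<beta>) ^ k"
    have h: "(\<lambda>k. fps_nth H k * (t - \<beta>) ^ k) sums h t"
      using r' that by simp
    have "(\<lambda>k. ?e (Suc k)) sums ((t - \<beta>) * h t)"
      using sums_mult_ultrametric[OF h, of "t - \<beta>"] by (simp add: mult_ac)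
    from sums_Suc[OF this] have "?e sums ((t - \<beta>) * h t)"
      by simp
    from sums_add[OF sums_mult_ultrametric[OF h, of "\<beta> - \<alpha>"] this]
    have "(\<lambda>k. (\<beta> - \<alpha>) * (fps_nth H k * (t - \<beta>) ^ k) + ?e k) sums ((t - \<alpha>) * h t)"
      by (simp add: algebra_simps)
    moreover have "fps_nth ?F k * (t - \<beta>) ^ k = (\<beta> - \<alpha>) * (fps_nth H k * (t - \<beta>) ^ k) + ?e k" for k
      by (simp add: distrib_right mult.assoc)
    ultimately show ?thesis
      using assms(3) that by simp
  qed
  with \<open>r' > 0\<close> assms(2) show ?thesis
    unfolding has_expansion_at_def by (intro exI[of _ "min r r'"]) auto
qed

text \<open>
  Dividing \<open>K\<close> times by \<open>t - \<beta>\<close> gives a Taylor polynomial of degree below \<open>K\<close> with remainder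
  \<open>(t - \<beta>) ^ K\<close> times the \<open>K\<close>-th quotient. Each division costs at most a factor \<open>1 / r\<close> in the
  coefficient bound, so the remainder tends to \<open>0\<close> when \<open>absval (t - \<beta>) < r\<close>. This recentres the
  series without interchanging a double sum.
\<close>

lemma has_expansion_at_power_series:
  fixes a :: "nat \<Rightarrow> 'a::{ultrametric_field,complete_space}"
  assumes "converges_on_disc r a" "absval \<beta> \<le> r"
  shows "\<exists>F. has_expansion_at (power_series a) \<beta> F"
proof -
  define b where "b k = (difference_quotient \<beta> ^^ k) a" for k
  have b_Suc: "b (Suc k) = difference_quotient \<beta> (b k)" for k
    by (simp add: b_def)
  have b: "converges_on_disc r (b k)" for k
  proof (induction k)
    case (Suc k)
    then show ?case
      unfolding b_Suc by (rule converges_on_disc_difference_quotient[OF _ assms(2)])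
  qed (simp add: b_def assms)
  have r: "r > 0"
    using assms(1) by (simp add: converges_on_disc_def)
  obtain B where B: "B > 0" "\<And>n. absval (a n) * r ^ n \<le> B"
    using bounded_on_disc[OF assms(1)] by blast
  have b_bound: "absval (b k n) * r ^ n \<le> B / r ^ k" for k n
  proof (induction k arbitrary: n)
    case (Suc k)
    show ?case
      using difference_quotient_bound[OF b assms(2) Suc, of n] by (simp add: b_Suc mult.commute)
  qed (simp add: b_def B)
  have Taylor: "power_series a t =
      (\<Sum>k<K. power_series (b k) \<beta> * (t - \<beta>) ^ k) + (t - \<beta>) ^ K * power_series (b K) t"
    if "absval t \<le> r" for t K
  proof (induction K)
    case (Suc K)
    then show ?case
      unfolding power_series_difference_quotient[OF b assms(2) that, of K] b_Suc
      by (simp add: algebra_simps)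
  qed (simp add: b_def)
  have "(\<lambda>k. power_series (b k) \<beta> * (t - \<beta>) ^ k) sums power_series a t" if "t \<in> ball \<beta> r" for t
  proof -
    have t\<beta>: "absval (t - \<beta>) < r"
      using that by (simp add: dist_absval absval_minus_commute)
    then have t: "absval t \<le> r"
      using absval_add_le_max[of "t - \<beta>" \<beta>] assms(2) by simp
    have "(\<lambda>K. absval ((\<Sum>k<K. power_series (b k) \<beta> * (t - \<beta>) ^ k) - power_series a t)) \<longlonglongrightarrow> 0"
    proof (rule absval_tendsto_0_comparison)
      fix K
      have "absval ((\<Sum>k<K. power_series (b k) \<beta> * (t - \<beta>) ^ k) - power_series a t) =
          absval (t - \<beta>) ^ K * absval (power_series (b K) t)"
        unfolding Taylor[OF t, of K] by (simp add: absval_mult absval_power)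
      also have "\<dots> \<le> absval (t - \<beta>) ^ K * (B / r ^ K)"
        by (intro mult_left_mono absval_power_series_le[OF b t b_bound]) simp
      finally show "absval ((\<Sum>k<K. power_series (b k) \<beta> * (t - \<beta>) ^ k) - power_series a t)
          \<le> B * (absval (t - \<beta>) / r) ^ K"
        by (simp add: power_divide mult.commute)
      show "(\<lambda>K. B * (absval (t - \<beta>) / r) ^ K) \<longlonglongrightarrow> 0"
        using t\<beta> r by (intro tendsto_mult_right_zero LIMSEQ_power_zero) simp
    qed
    then show ?thesis
      unfolding sums_def tendsto_absval_iff .
  qed
  then have "has_expansion_at (power_series a) \<beta> (Abs_fps (\<lambda>k. power_series (b k) \<beta>))"
    unfolding has_expansion_at_def using r by auto
  then show ?thesis
    by blast
qed

lemma vanishing_order_translate: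
  fixes a :: "nat \<Rightarrow> 'a::{ultrametric_field,complete_space}"
  assumes "\<pi> \<noteq> (0::'a)" "absval \<pi> < 1" "converges_on_disc r a" "absval (q - c) \<le> r"
  shows "vanishing_order (\<lambda>Q. power_series a (Q - c)) q = vanishing_order (power_series a) (q - c)"
proof -
  obtain F where "has_expansion_at (power_series a) (q - c) F"
    using has_expansion_at_power_series[OF assms(3,4)] by blast
  with has_expansion_at_translate[OF this] show ?thesis
    using vanishing_order_eq_subdegree[OF assms(1,2)] by metis
qed

section \<open>The number of zeros\<close>

definition disc_zeros :: "real \<Rightarrow> (nat \<Rightarrow> 'a::ultrametric_field) \<Rightarrow> 'a set" where
  "disc_zeros r a = {t. absval t \<le> r \<and> power_series a t = 0}"

text \<open>
  Splitting off a zero \<open>\<alpha>\<close> lowers the Weierstrass degree by one. It also lowers the vanishing order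
  by one at \<open>\<alpha>\<close> and leaves it alone elsewhere, since the expansion of \<open>t - \<alpha>\<close> at \<open>\<beta>\<close> is
  \<open>(\<beta> - \<alpha>) + X\<close>. The orders are additive only if no expansion is the zero series, and this is
  carried through the same induction.
\<close>

theorem sum_vanishing_order_disc_zeros:
  fixes a :: "nat \<Rightarrow> 'a::complete_alg_closed_ultrametric_field"
  assumes "\<pi> \<noteq> (0::'a)" "absval \<pi> < 1" "distinguished r a d"
  shows "finite (disc_zeros r a)"
    and "(\<Sum>\<beta>\<in>disc_zeros r a. vanishing_order (power_series a) \<beta>) = d"
proof -
  have "finite (disc_zeros r a) \<and> (\<Sum>\<beta>\<in>disc_zeros r a. vanishing_order (power_series a) \<beta>) = d \<and>
    (\<forall>\<beta> F. absval \<beta> \<le> r \<longrightarrow> has_expansion_at (power_series a) \<beta> F \<longrightarrow> F \<noteq> 0)"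
    using assms(3)
  proof (induction d arbitrary: a)
    case (0 a)
    have "power_series a t \<noteq> 0" if "absval t \<le> r" for t
      using absval_power_series_distinguished_0[OF 0 that] distinguishedD(2)[OF 0]
      by (metis absval_eq_0_iff)
    moreover from this have "disc_zeros r a = {}"
      by (auto simp: disc_zeros_def)
    ultimately show ?case
      by (auto dest: has_expansion_at_value)
  next
    case (Suc d a)
    note conv = distinguishedD(1)[OF Suc.prems]
    obtain \<alpha> where \<alpha>: "absval \<alpha> \<le> r" "power_series a \<alpha> = 0"
      using ex_zero_power_series[OF Suc.prems] by blast
    let ?b = "difference_quotient \<alpha> a"
    have factor: "power_series a t = (t - \<alpha>) * power_series ?b t" if "absval t \<le> r" for t
      using power_series_difference_quotient[OF conv \<alpha>(1) that] \<alpha>(2) by simp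
    from Suc.IH[OF distinguished_difference_quotient(1)[OF Suc.prems \<alpha>(1)]]
    have b: "finite (disc_zeros r ?b)"
        "(\<Sum>\<beta>\<in>disc_zeros r ?b. vanishing_order (power_series ?b) \<beta>) = d"
      and b_nz: "\<And>\<beta> F. absval \<beta> \<le> r \<Longrightarrow> has_expansion_at (power_series ?b) \<beta> F \<Longrightarrow> F \<noteq> 0"
      by auto
    have zeros: "disc_zeros r a = insert \<alpha> (disc_zeros r ?b)"
      using \<alpha> factor by (auto simp: disc_zeros_def)
    have expansion: "\<exists>H. has_expansion_at (power_series ?b) \<beta> H \<and>
        has_expansion_at (power_series a) \<beta> ((fps_const (\<beta> - \<alpha>) + fps_X) * H)"
      if "absval \<beta> \<le> r" for \<beta>
    proof -
      obtain H where H: "has_expansion_at (power_series ?b) \<beta> H"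
        using has_expansion_at_power_series
            [OF converges_on_disc_difference_quotient[OF conv \<alpha>(1)] \<open>absval \<beta> \<le> r\<close>]
        by blast
      have "absval t \<le> r" if "t \<in> ball \<beta> r" for t
        using absval_diff_le_max[of \<beta> "\<beta> - t"] \<open>absval \<beta> \<le> r\<close> that by (simp add: dist_absval)
      then show ?thesis
        using has_expansion_at_linear_factor[OF H distinguishedD(3)[OF Suc.prems], of "power_series a" \<alpha>]
          H factor by blast
    qed
    have linear: "fps_const c + fps_X \<noteq> 0 \<and> subdegree (fps_const c + fps_X) = (if c = 0 then 1 else 0)"
      for c :: 'a
      by (auto simp: fps_eq_iff intro: exI[of _ 1])
    have order: "vanishing_order (power_series a) \<beta> =
        vanishing_order (power_series ?b) \<beta> + (if \<beta> = \<alpha> then 1 else 0)" if "absval \<beta> \<le> r" for \<beta>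
    proof -
      obtain H where H: "has_expansion_at (power_series ?b) \<beta> H"
        "has_expansion_at (power_series a) \<beta> ((fps_const (\<beta> - \<alpha>) + fps_X) * H)"
        using expansion[OF \<open>absval \<beta> \<le> r\<close>] by blast
      then show ?thesis
        using linear[of "\<beta> - \<alpha>"] b_nz[OF that H(1)]
          vanishing_order_eq_subdegree[OF assms(1,2) H(1)] vanishing_order_eq_subdegree[OF assms(1,2) H(2)]
        by (simp add: subdegree_mult)
    qed
    have "(\<Sum>\<beta>\<in>disc_zeros r a. vanishing_order (power_series a) \<beta>) =
        (\<Sum>\<beta>\<in>disc_zeros r a. vanishing_order (power_series ?b) \<beta> + (if \<beta> = \<alpha> then 1 else 0))"
      by (rule sum.cong) (auto simp: order disc_zeros_def)
    also have "\<dots> = (\<Sum>\<beta>\<in>disc_zeros r a. vanishing_order (power_series ?b) \<beta>) + 1"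
      using b(1) by (simp add: sum.distrib zeros sum.delta)
    also have "(\<Sum>\<beta>\<in>disc_zeros r a. vanishing_order (power_series ?b) \<beta>) =
        (\<Sum>\<beta>\<in>disc_zeros r ?b. vanishing_order (power_series ?b) \<beta>)"
    proof (rule sum.mono_neutral_right)
      show "\<forall>\<beta>\<in>disc_zeros r a - disc_zeros r ?b. vanishing_order (power_series ?b) \<beta> = 0"
      proof
        fix \<beta>
        assume "\<beta> \<in> disc_zeros r a - disc_zeros r ?b"
        then have "absval \<beta> \<le> r" "power_series ?b \<beta> \<noteq> 0"
          by (auto simp: disc_zeros_def)
        then show "vanishing_order (power_series ?b) \<beta> = 0"
          using expansion[of \<beta>] has_expansion_at_value vanishing_order_eq_subdegree[OF assms(1,2)]
          by (metis subdegree_eq_0)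
      qed
    qed (use b(1) zeros in auto)
    finally have sum: "(\<Sum>\<beta>\<in>disc_zeros r a. vanishing_order (power_series a) \<beta>) = Suc d"
      using b(2) by simp
    moreover have "F \<noteq> 0" if "absval \<beta> \<le> r" "has_expansion_at (power_series a) \<beta> F" for \<beta> F
      using expansion[OF that(1)] b_nz[OF that(1)] linear[of "\<beta> - \<alpha>"]
        has_expansion_at_unique[OF assms(1,2) that(2)] by (metis no_zero_divisors)
    ultimately show ?case
      using b(1) zeros by simp
  qed
  then show "finite (disc_zeros r a)"
    and "(\<Sum>\<beta>\<in>disc_zeros r a. vanishing_order (power_series a) \<beta>) = d"
    by blast+
qed

section \<open>Factorials in the p-adic absolute value\<close>

text \<open>The radius of convergence of the \<open>p\<close>-adic exponential series.\<close>

definition exp_radius :: "nat \<Rightarrow> real" where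
  "exp_radius p = real p powr (- 1 / (real p - 1))"

lemma exp_radius:
  assumes "p > 1"
  shows "exp_radius p > 0" "exp_radius p < 1" "exp_radius p ^ (p - 1) = 1 / real p"
proof -
  show "exp_radius p > 0"
    using assms by (simp add: exp_radius_def)
  have "exp_radius p ^ (p - 1) = exp_radius p powr (real p - 1)"
    using assms \<open>exp_radius p > 0\<close> by (simp flip: powr_realpow)
  also have "\<dots> = real p powr (- 1)"
    using assms by (simp add: exp_radius_def powr_powr)
  also have "\<dots> = 1 / real p"
    using assms by (simp add: powr_minus inverse_eq_divide)
  finally show pow: "exp_radius p ^ (p - 1) = 1 / real p" .
  show "exp_radius p < 1"
  proof (rule ccontr)
    assume "\<not> exp_radius p < 1"
    then have "exp_radius p ^ (p - 1) \<ge> 1"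
      by (intro one_le_power) simp
    then show False
      using pow assms by simp
  qed
qed

context
  fixes p :: nat
  assumes prime_p: "prime p"
    and absval_p: "absval (of_nat p :: 'a::ultrametric_field) = 1 / real p"
begin

lemma absval_of_int_le_1: "absval (of_int k :: 'a) \<le> 1"
  by (cases k rule: int_cases2) (auto simp: absval_of_nat_le_1)

lemma absval_of_nat_eq_1:
  assumes "\<not> p dvd n"
  shows "absval (of_nat n :: 'a) = 1"
proof (rule ccontr)
  assume "absval (of_nat n :: 'a) \<noteq> 1"
  then have n: "absval (of_nat n :: 'a) < 1"
    using absval_of_nat_le_1[of n, where ?'a = 'a] by simp
  have "coprime (int n) (int p)"
    using prime_imp_coprime[OF prime_p assms] by (simp add: coprime_commute)
  then obtain u v where "u * int n + v * int p = 1"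
    using bezout_int[of "int n" "int p"] by auto
  then have "of_int (u * int n + v * int p) = (1 :: 'a)"
    by simp
  then have one: "of_int u * of_nat n + of_int v * of_nat p = (1 :: 'a)"
    by simp
  have "absval (of_int u * of_nat n :: 'a) \<le> absval (of_nat n :: 'a)"
    "absval (of_int v * of_nat p :: 'a) \<le> absval (of_nat p :: 'a)"
    unfolding absval_mult by (intro mult_left_le_one_le absval_of_int_le_1 absval_nonneg)+
  moreover have "absval (of_nat p :: 'a) < 1"
    using prime_gt_1_nat[OF prime_p] by (simp add: absval_p)
  ultimately have "absval (of_int u * of_nat n + of_int v * of_nat p :: 'a) < 1"
    using n absval_add_le_max[of "of_int u * of_nat n :: 'a" "of_int v * of_nat p"] by linarith
  then show False
    by (simp add: one)
qed

lemma absval_fact_eq_1: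
  assumes "m < p"
  shows "absval (fact m :: 'a) = 1"
  using absval_of_nat_eq_1[of "fact m"] assms prime_dvd_fact_iff[OF prime_p, of m] by simp

lemma absval_fact_p: "absval (fact p :: 'a) = 1 / real p"
proof -
  have "fact p = (of_nat p * fact (p - 1) :: 'a)"
    using prime_gt_0_nat[OF prime_p] by (rule fact_reduce)
  then show ?thesis
    using absval_fact_eq_1[of "p - 1"] prime_gt_0_nat[OF prime_p] by (simp add: absval_mult absval_p)
qed

lemma absval_fact_add_less:
  assumes "j < p"
  shows "absval (fact (p * k + j) :: 'a) = absval (fact (p * k) :: 'a)"
  using assms
proof (induction j)
  case (Suc j)
  have "\<not> p dvd Suc j"
    using Suc.prems by (meson dvd_imp_le not_less zero_less_Suc)
  then have "\<not> p dvd p * k + Suc j"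
    by (metis dvd_add_right_iff dvd_triv_left)
  then have "absval (of_nat (p * k + Suc j) :: 'a) = 1"
    by (rule absval_of_nat_eq_1)
  moreover have "fact (p * k + Suc j) = (of_nat (p * k + Suc j) * fact (p * k + j) :: 'a)"
    by (metis add_Suc_right fact_Suc)
  ultimately show ?case
    using Suc by (simp add: absval_mult)
qed simp

lemma absval_fact_mult: "absval (fact (p * k) :: 'a) = (1 / real p) ^ k * absval (fact k :: 'a)"
proof (induction k)
  case (Suc k)
  have p: "p > 0"
    using prime_p by (rule prime_gt_0_nat)
  then have "fact (p * Suc k) = (of_nat (p * Suc k) * fact (p * Suc k - 1) :: 'a)"
    by (intro fact_reduce) simp
  also have "p * Suc k - 1 = p * k + (p - 1)"
    using p by simp
  finally have "fact (p * Suc k) = (of_nat p * of_nat (Suc k) * fact (p * k + (p - 1)) :: 'a)"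
    by (simp only: of_nat_mult)
  moreover have "absval (fact (p * k + (p - 1)) :: 'a) = (1 / real p) ^ k * absval (fact k :: 'a)"
    using absval_fact_add_less[of "p - 1" k] p Suc by simp
  moreover have "fact (Suc k) = (of_nat (Suc k) * fact k :: 'a)"
    by simp
  ultimately show ?case
    by (simp only: absval_mult absval_p power_Suc) simp
qed simp

text \<open>
  This is Legendre's bound \<open>v(m!) \<le> (m - 1) / (p - 1)\<close>. Grouping the factors of \<open>m!\<close> by multiples
  of \<open>p\<close> reduces \<open>m\<close> to \<open>k = m div p\<close> at the cost of \<open>k\<close> factors \<open>p\<close>, and
  \<open>(p - 1) k + (k - 1) = p k - 1 \<le> m - 1\<close>.
\<close>

lemma absval_fact_ge: "m > 0 \<Longrightarrow> exp_radius p ^ (m - 1) \<le> absval (fact m :: 'a)"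
proof (induction m rule: less_induct)
  case (less m)
  note p = prime_gt_1_nat[OF prime_p]
  note rad = exp_radius[OF p]
  show ?case
  proof (cases "m < p")
    case True
    then show ?thesis
      using rad by (simp add: absval_fact_eq_1 power_le_one)
  next
    case False
    define k j where "k = m div p" and "j = m mod p"
    have m: "m = p * k + j" and j: "j < p"
      using p by (auto simp: k_def j_def)
    have k: "k > 0" "k < m"
      using False p by (auto simp: k_def div_greater_zero_iff)
    have "(p - 1) * k + (k - 1) = p * k - 1"
      using p k(1) by (simp add: diff_mult_distrib)
    then have "(p - 1) * k + (k - 1) \<le> m - 1"
      using m by simp
    then have "exp_radius p ^ (m - 1) \<le> exp_radius p ^ ((p - 1) * k + (k - 1))"
      using rad by (intro power_decreasing) auto
    also have "\<dots> = (1 / real p) ^ k * exp_radius p ^ (k - 1)"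
      by (simp only: power_add power_mult rad(3))
    also have "\<dots> \<le> (1 / real p) ^ k * absval (fact k :: 'a)"
      by (intro mult_left_mono less.IH k) simp
    also have "\<dots> = absval (fact m :: 'a)"
      unfolding m absval_fact_add_less[OF j] absval_fact_mult ..
    finally show ?thesis .
  qed
qed

end

section \<open>The coefficients of the fixed-point series\<close>

definition g_coeff :: "'a::ultrametric_field \<Rightarrow> nat \<Rightarrow> 'a" where
  "g_coeff x n = A n x / fact (n + 2)"

lemma g_eq_power_series: "g x Q = power_series (g_coeff x) (Q - 1)"
  by (simp add: g_def g_coeff_def power_series_def)

lemma absval_diff_of_nat_le_1:
  fixes x :: "'a::ultrametric_field"
  assumes "x \<in> O_p"
  shows "absval (x - of_nat k) \<le> 1"
  using absval_diff_le_max[of x "of_nat k"] absval_of_nat_le_1[of k, where ?'a = 'a] assms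
  by (simp add: O_p_def)

lemma absval_A_le_1:
  fixes x :: "'a::ultrametric_field"
  assumes "x \<in> O_p"
  shows "absval (A n x) \<le> 1"
  unfolding A_def absval_prod by (intro prod_le_1 conjI absval_nonneg absval_diff_of_nat_le_1 assms)

lemma absval_A_antimono:
  fixes x :: "'a::ultrametric_field"
  assumes "x \<in> O_p" "m \<le> n"
  shows "absval (A n x) \<le> absval (A m x)"
proof -
  have "{2..n+1} = {2..m+1} \<union> {m+2..n+1}"
    using assms(2) by auto
  then have "absval (A n x) = absval (A m x) * (\<Prod>k=m+2..n+1. absval (x - of_nat k))"
    unfolding A_def absval_prod by (simp add: prod.union_disjoint)
  also have "\<dots> \<le> absval (A m x)"
    by (intro mult_right_le_one_le prod_nonneg prod_le_1 conjI absval_nonneg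
          absval_diff_of_nat_le_1 assms(1) ballI)
  finally show ?thesis .
qed

text \<open>
  Here \<open>e\<close> stands for \<open>p - 2\<close>, the index of the coefficient whose denominator is \<open>p!\<close>. Together
  with the constant term, which is the unit \<open>1/2\<close> because \<open>p\<close> is odd, it controls all zeros.
\<close>

context
  fixes p e :: nat and x :: "'a::{ultrametric_field,complete_space}"
  assumes prime_p: "prime p"
    and absval_p: "absval (of_nat p :: 'a) = 1 / real p"
    and p_eq: "p = e + 2" and e_pos: "e > 0"
    and x: "x \<in> O_p"
begin

private lemma p_gt_1: "p > 1"
  using p_eq by simp

private lemmas rad = exp_radius[OF p_gt_1]

lemma absval_g_coeff_0: "absval (g_coeff x 0) = 1"
proof -
  have "absval (fact 2 :: 'a) = 1"
    by (rule absval_fact_eq_1[OF prime_p absval_p]) (use p_eq e_pos in simp)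
  then show ?thesis
    by (simp add: g_coeff_def A_def absval_divide)
qed

lemma absval_g_coeff_le_1:
  assumes "n < e"
  shows "absval (g_coeff x n) \<le> 1"
proof -
  have "absval (fact (n + 2) :: 'a) = 1"
    by (rule absval_fact_eq_1[OF prime_p absval_p]) (use p_eq assms in simp)
  then show ?thesis
    using absval_A_le_1[OF x, of n] by (simp only: g_coeff_def absval_divide)
qed

lemma absval_g_coeff_e: "absval (g_coeff x e) = absval (A e x) * real p"
  using absval_fact_p[OF prime_p absval_p] p_eq by (simp only: g_coeff_def absval_divide) simp

lemma absval_g_coeff_le: "absval (g_coeff x n) * exp_radius p ^ (n + 1) \<le> absval (A n x)"
proof -
  have "exp_radius p ^ (n + 1) \<le> absval (fact (n + 2) :: 'a)"
    using absval_fact_ge[OF prime_p absval_p, of "n + 2"] by simp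
  then have "absval (g_coeff x n) * exp_radius p ^ (n + 1)
      \<le> absval (g_coeff x n) * absval (fact (n + 2) :: 'a)"
    by (rule mult_left_mono) simp
  also have "\<dots> = absval (A n x)"
    unfolding g_coeff_def absval_divide by (simp del: fact_Suc)
  finally show ?thesis .
qed

lemma g_coeff_converges:
  assumes "0 < r" "r < exp_radius p"
  shows "converges_on_disc r (g_coeff x)"
proof -
  let ?\<rho> = "exp_radius p"
  have le: "absval (g_coeff x n) * r ^ n \<le> 1 / ?\<rho> * (r / ?\<rho>) ^ n" for n
  proof -
    have "absval (g_coeff x n) * ?\<rho> ^ (n + 1) \<le> 1"
      using absval_g_coeff_le[of n] absval_A_le_1[OF x, of n] by linarith
    then have "absval (g_coeff x n) \<le> 1 / ?\<rho> ^ (n + 1)"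
      using rad(1) by (simp add: pos_le_divide_eq)
    from mult_right_mono[OF this, of "r ^ n"] show ?thesis
      using assms(1) by (simp add: power_divide)
  qed
  have lim: "(\<lambda>n. 1 / ?\<rho> * (r / ?\<rho>) ^ n) \<longlonglongrightarrow> 0"
    using assms by (intro tendsto_mult_right_zero LIMSEQ_power_zero) simp
  have "(\<lambda>n. absval (g_coeff x n) * r ^ n) \<longlonglongrightarrow> 0"
    by (rule tendsto_sandwich[OF _ _ tendsto_const lim])
       (use le assms(1) in \<open>auto intro!: always_eventually\<close>)
  with assms(1) show ?thesis
    by (simp add: converges_on_disc_def)
qed

text \<open>
  Beyond the index \<open>e\<close> the numerator is a multiple of \<open>A e x\<close>, and Legendre's bound is attained at
  \<open>p!\<close>, so passing from \<open>e\<close> to \<open>n\<close> enlarges the coefficient by at most \<open>exp_radius p\<close> to the power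
  \<open>- (n - e)\<close>, which \<open>r ^ (n - e)\<close> outweighs.
\<close>

lemma g_coeff_tail_less:
  assumes "0 < r" "r < exp_radius p" "n > e" "A e x \<noteq> 0"
  shows "absval (g_coeff x n) * r ^ n < absval (g_coeff x e) * r ^ e"
proof -
  let ?\<rho> = "exp_radius p"
  have exponents: "n + 1 = (n - e) + (p - 1)" "n = e + (n - e)"
    using assms(3) p_eq by auto
  have "absval (g_coeff x n) * ?\<rho> ^ (n + 1) \<le> absval (A e x)"
    using absval_g_coeff_le[of n] absval_A_antimono[OF x, of e n] assms(3) by linarith
  then have "absval (g_coeff x n) * ?\<rho> ^ (n + 1) * r ^ n \<le> absval (A e x) * r ^ n"
    using assms(1) by (intro mult_right_mono) auto
  also have "\<dots> = absval (A e x) * r ^ e * r ^ (n - e)"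
    by (subst exponents(2)) (simp only: power_add mult_ac)
  also have "\<dots> < absval (A e x) * r ^ e * ?\<rho> ^ (n - e)"
    using assms by (intro mult_strict_left_mono power_strict_mono) auto
  also have "\<dots> = absval (g_coeff x e) * r ^ e * ?\<rho> ^ (n + 1)"
    unfolding exponents(1) power_add rad(3) absval_g_coeff_e using p_gt_1 by simp
  finally have "absval (g_coeff x n) * r ^ n * ?\<rho> ^ (n + 1) < absval (g_coeff x e) * r ^ e * ?\<rho> ^ (n + 1)"
    by (simp only: mult_ac)
  then show ?thesis
    using rad(1) by (simp only: mult_less_cancel_right_pos zero_less_power)
qed

lemma g_coeff_eq_0:
  assumes "A e x = 0" "n \<ge> e"
  shows "g_coeff x n = 0"
proof -
  have "absval (A n x) \<le> 0"
    using absval_A_antimono[OF x assms(2)] assms(1) by simp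
  then have "A n x = 0"
    using absval_nonneg[of "A n x"] by (metis absval_eq_0_iff order_antisym)
  then show ?thesis
    by (simp add: g_coeff_def)
qed

lemma g_coeff_head_le:
  assumes "0 < r" "r < exp_radius p" "n < e"
  shows "absval (g_coeff x n) * r ^ n \<le> 1"
    and "n > 0 \<Longrightarrow> absval (g_coeff x n) * r ^ n < 1"
proof -
  have r: "r < 1"
    using assms(2) rad(2) by simp
  have "absval (g_coeff x n) * r ^ n \<le> r ^ n"
    using absval_g_coeff_le_1[OF assms(3)] assms(1) by (intro mult_left_le_one_le) auto
  moreover have "r ^ n \<le> 1" "n > 0 \<Longrightarrow> r ^ n < 1"
    using r assms(1) by (auto intro: power_le_one simp: power_less_one_iff)
  ultimately show "absval (g_coeff x n) * r ^ n \<le> 1" "n > 0 \<Longrightarrow> absval (g_coeff x n) * r ^ n < 1"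
    by auto
qed

text \<open>
  If the terms of index \<open>0\<close> and \<open>e\<close> had different absolute values, then the larger of them would
  strictly dominate all terms.
\<close>

lemma g_zero_radius:
  assumes "power_series (g_coeff x) t = 0" "absval t < exp_radius p"
  shows "absval (A e x) * real p * absval t ^ e = 1" "t \<noteq> 0"
proof -
  have "power_series (g_coeff x) 0 = g_coeff x 0"
    unfolding power_series_def by (subst suminf_finite[of "{0}"]) auto
  then show "t \<noteq> 0"
    using assms(1) absval_g_coeff_0 by auto
  define r where "r = absval t"
  have r: "0 < r" "r < exp_radius p"
    using \<open>t \<noteq> 0\<close> assms(2) by (auto simp: r_def)
  note conv = g_coeff_converges[OF r]
  let ?v = "absval (g_coeff x e) * r ^ e"
  have scaled: "absval (g_coeff x n * t ^ n) = absval (g_coeff x n) * r ^ n" for n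
    by (simp add: absval_mult absval_power r_def)
  have dominant: False
    if "g_coeff x d \<noteq> 0" "\<And>n. n \<noteq> d \<Longrightarrow> absval (g_coeff x n) * r ^ n < absval (g_coeff x d) * r ^ d"
    for d
  proof -
    have "absval (power_series (g_coeff x) t) = absval (g_coeff x d * t ^ d)"
      unfolding power_series_def
    proof (rule absval_suminf_dominant)
      show "summable (\<lambda>n. g_coeff x n * t ^ n)"
        by (rule sums_summable[OF power_series_sums[OF conv]]) (simp add: r_def)
    qed (use that \<open>t \<noteq> 0\<close> in \<open>auto simp only: scaled\<close>, simp add: that(1))
    then show False
      using assms(1) that(1) \<open>t \<noteq> 0\<close> by simp
  qed
  have tail: "absval (g_coeff x n) * r ^ n < max 1 ?v" if "n > e" for n
  proof (cases "A e x = 0")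
    case True
    then show ?thesis
      using g_coeff_eq_0[of n] that by simp
  next
    case False
    then show ?thesis
      using g_coeff_tail_less[OF r that False] by simp
  qed
  have "?v = 1"
  proof (rule ccontr)
    assume "?v \<noteq> 1"
    then consider "?v < 1" | "?v > 1"
      by linarith
    then show False
    proof cases
      case 1
      show False
      proof (rule dominant[of 0])
        fix n :: nat
        assume "n \<noteq> 0"
        then show "absval (g_coeff x n) * r ^ n < absval (g_coeff x 0) * r ^ 0"
          using 1 tail[of n] g_coeff_head_le(2)[OF r, of n] absval_g_coeff_0
          by (cases n e rule: linorder_cases) auto
      qed (use absval_g_coeff_0 in auto)
    next
      case 2
      show False
      proof (rule dominant[of e])
        fix n
        assume "n \<noteq> e"
        then show "absval (g_coeff x n) * r ^ n < ?v"
          using 2 tail[of n] g_coeff_head_le(1)[OF r, of n]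
          by (cases n e rule: linorder_cases) auto
      qed (use 2 in auto)
    qed
  qed
  then show "absval (A e x) * real p * absval t ^ e = 1"
    by (simp add: absval_g_coeff_e r_def)
qed

lemma g_zero_absval_A_gt:
  assumes "power_series (g_coeff x) t = 0" "absval t < exp_radius p"
  shows "absval (A e x) > exp_radius p"
proof -
  let ?\<rho> = "exp_radius p"
  note zero = g_zero_radius[OF assms]
  have "1 = absval (A e x) * real p * absval t ^ e"
    using zero(1) by simp
  also have "\<dots> < absval (A e x) * real p * ?\<rho> ^ e"
    using zero assms(2) e_pos p_gt_1
    by (intro mult_strict_left_mono power_strict_mono) (auto intro!: mult_pos_pos)
  finally have "?\<rho> < absval (A e x) * real p * ?\<rho> ^ (p - 1)"
    using mult_strict_right_mono[of 1 "absval (A e x) * real p * ?\<rho> ^ e" ?\<rho>] rad(1) p_eq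
    by (simp add: mult_ac)
  then show ?thesis
    unfolding rad(3) using p_gt_1 by simp
qed

text \<open>
  On the circle where the terms of index \<open>0\<close> and \<open>e\<close> balance, the last dominant index is \<open>e\<close>. The
  hypothesis on \<open>A e x\<close> says exactly that this circle lies in the open disc of radius
  \<open>exp_radius p\<close>.
\<close>

lemma g_coeff_distinguished:
  assumes "absval (A e x) > exp_radius p"
  obtains r where "r > 0" "r < exp_radius p" "absval (A e x) * real p * r ^ e = 1"
    "distinguished r (g_coeff x) e"
proof -
  let ?\<rho> = "exp_radius p"
  have A: "absval (A e x) > 0" "A e x \<noteq> 0"
    using assms rad(1) by (auto simp flip: absval_pos_iff)
  define r where "r = root e (1 / (absval (A e x) * real p))"
  have r: "r > 0" "r ^ e = 1 / (absval (A e x) * real p)"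
    using A p_gt_1 e_pos by (auto simp: r_def)
  then have eq: "absval (A e x) * real p * r ^ e = 1"
    using A p_gt_1 by simp
  have "r ^ e = ?\<rho> ^ (p - 1) / absval (A e x)"
    unfolding r(2) rad(3) by simp
  also have "\<dots> < ?\<rho> ^ (p - 1) / ?\<rho>"
    using assms rad(1) A by (intro divide_strict_left_mono) auto
  also have "\<dots> = ?\<rho> ^ e"
    using rad(1) p_eq by simp
  finally have r_less: "r < ?\<rho>"
    using rad(1) by (intro power_less_imp_less_base[of r e]) auto
  have lead: "absval (g_coeff x e) * r ^ e = 1"
    using eq by (simp add: absval_g_coeff_e)
  have "distinguished r (g_coeff x) e"
    unfolding distinguished_def lead
  proof (intro conjI allI impI)
    show "converges_on_disc r (g_coeff x)"
      by (rule g_coeff_converges[OF r(1) r_less])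
    show "g_coeff x e \<noteq> 0"
      using lead by auto
    show tail: "absval (g_coeff x n) * r ^ n < 1" if "n > e" for n
      using g_coeff_tail_less[OF r(1) r_less that A(2)] lead by simp
    show "absval (g_coeff x n) * r ^ n \<le> 1" for n
      using g_coeff_head_le(1)[OF r(1) r_less, of n] lead tail[of n]
      by (cases n e rule: linorder_cases) auto
  qed
  with r(1) r_less eq show thesis
    by (rule that)
qed

end

section \<open>Nontrivial fixed points\<close>

lemma M_iff:
  "(x, q) \<in> M p \<longleftrightarrow>
    x \<in> O_p \<and> absval (q - 1) < exp_radius p \<and> power_series (g_coeff x) (q - 1) = 0"
  by (auto simp: M_def q_disc_def exp_radius_def g_eq_power_series dist_absval absval_minus_commute)

theorem proposition4:
  fixes p :: nat
  assumes "is_C_p p TYPE('a::complete_alg_closed_ultrametric_field)"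
    and "p \<noteq> 2"
  shows "\<phi>\<^sub>1_has_degree p TYPE('a) (p - 2) \<and>
    \<phi>\<^sub>1 ` M p = {x \<in> (O_p :: 'a set). absval (A (p - 2) x) > real p powr (- 1 / (real p - 1))} \<and>
    (\<forall>x q :: 'a. (x, q) \<in> M p \<longrightarrow>
       absval (A (p - 2) x) = real p powr ((real p - 2) * valuation p (q - 1) - 1))"
proof -
  have prime: "prime p" and absval_p: "absval (of_nat p :: 'a) = 1 / real p"
    using assms(1) by (auto simp: is_C_p_def)
  have "p > 2"
    using prime_ge_2_nat[OF prime] assms(2) by simp
  define e where "e = p - 2"
  have e: "p = e + 2" "e > 0"
    using \<open>p > 2\<close> by (auto simp: e_def)
  note zero_radius = g_zero_radius[OF prime absval_p e]
    and absval_A_gt = g_zero_absval_A_gt[OF prime absval_p e]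
    and distinguished = g_coeff_distinguished[OF prime absval_p e]
  have \<pi>: "of_nat p \<noteq> (0 :: 'a)" "absval (of_nat p :: 'a) < 1"
    using \<open>p > 2\<close> by (auto simp: absval_p)

  have image: "\<phi>\<^sub>1 ` M p = {x \<in> (O_p :: 'a set). absval (A e x) > exp_radius p}"
  proof (intro equalityI subsetI)
    fix x :: 'a
    assume "x \<in> \<phi>\<^sub>1 ` M p"
    then obtain q where "(x, q) \<in> M p"
      by (auto simp: \<phi>\<^sub>1_def)
    then show "x \<in> {x \<in> O_p. absval (A e x) > exp_radius p}"
      using absval_A_gt[of x "q - 1"] by (auto simp: M_iff)
  next
    fix x :: 'a
    assume "x \<in> {x \<in> O_p. absval (A e x) > exp_radius p}"
    then have x: "x \<in> O_p" "absval (A e x) > exp_radius p"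
      by auto
    obtain r where r: "r < exp_radius p" "distinguished r (g_coeff x) (Suc (e - 1))"
      using distinguished[OF x] e(2) by (metis Suc_diff_1)
    obtain t where "absval t \<le> r" "power_series (g_coeff x) t = 0"
      using ex_zero_power_series[OF r(2)] by blast
    then have "(x, 1 + t) \<in> M p"
      using r(1) x(1) by (simp add: M_iff)
    then show "x \<in> \<phi>\<^sub>1 ` M p"
      by (force simp: \<phi>\<^sub>1_def)
  qed

  have degree: "\<phi>\<^sub>1_has_degree p TYPE('a) e"
    unfolding \<phi>\<^sub>1_has_degree_def
  proof
    fix x :: 'a
    assume "x \<in> \<phi>\<^sub>1 ` M p"
    then have x: "x \<in> O_p" "absval (A e x) > exp_radius p"
      unfolding image by auto
    obtain r where r: "r > 0" "r < exp_radius p" "absval (A e x) * real p * r ^ e = 1"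
      and dist: "distinguished r (g_coeff x) e"
      by (rule distinguished[OF x])
    let ?Z = "disc_zeros r (g_coeff x)"
    have fiber: "fiber p x = (\<lambda>t. (x, 1 + t)) ` ?Z"
    proof (intro equalityI subsetI)
      fix z
      assume "z \<in> fiber p x"
      then obtain q where z: "z = (x, q)" "(x, q) \<in> M p"
        by (cases z) (auto simp: fiber_def \<phi>\<^sub>1_def)
      then have q: "absval (q - 1) < exp_radius p" "power_series (g_coeff x) (q - 1) = 0"
        by (auto simp: M_iff)
      have eq: "absval (A e x) * real p * absval (q - 1) ^ e = absval (A e x) * real p * r ^ e"
        using zero_radius(1)[OF x(1) q(2,1)] r(3) by simp
      have nz: "absval (A e x) * real p \<noteq> 0"
        using r(3) by (metis mult_zero_left zero_neq_one)
      have "absval (q - 1) ^ e = r ^ e"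
        using eq unfolding mult_left_cancel[OF nz] .
      then have "absval (q - 1) = r"
        by (rule power_eq_imp_eq_base) (use r(1) e(2) in auto)
      then have "q - 1 \<in> ?Z"
        using q(2) by (simp add: disc_zeros_def)
      then show "z \<in> (\<lambda>t. (x, 1 + t)) ` ?Z"
        unfolding z(1) by (rule image_eqI[rotated]) simp
    next
      fix z
      assume "z \<in> (\<lambda>t. (x, 1 + t)) ` ?Z"
      then show "z \<in> fiber p x"
        using r(2) x(1) by (auto simp: fiber_def \<phi>\<^sub>1_def M_iff disc_zeros_def)
    qed
    have mult: "multiplicity_in_fiber (x, 1 + t) = vanishing_order (power_series (g_coeff x)) t"
      if "t \<in> ?Z" for t
      using vanishing_order_translate[OF \<pi> distinguishedD(1)[OF dist], of "1 + t" 1] that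
      by (simp add: multiplicity_in_fiber_def disc_zeros_def g_eq_power_series[abs_def])
    have "(\<Sum>z\<in>fiber p x. multiplicity_in_fiber z) =
        (\<Sum>t\<in>?Z. vanishing_order (power_series (g_coeff x)) t)"
      unfolding fiber by (subst sum.reindex) (auto simp: inj_on_def mult)
    then show "finite (fiber p x) \<and> (\<Sum>z\<in>fiber p x. multiplicity_in_fiber z) = e"
      using sum_vanishing_order_disc_zeros[OF \<pi> dist] fiber by simp
  qed

  have formula: "absval (A e x) = real p powr ((real p - 2) * valuation p (q - 1) - 1)"
    if "(x, q) \<in> M p" for x q :: 'a
  proof -
    define s where "s = absval (q - 1)"
    have "absval (A e x) * real p * s ^ e = 1" "s > 0"
      using zero_radius[of x "q - 1"] that by (auto simp: M_iff s_def)
    then have A: "absval (A e x) = inverse (s ^ e) / real p"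
      using \<open>p > 2\<close> by (simp add: field_simps)
    have "(real p - 2) * valuation p (q - 1) = log (real p) s * - real e"
      by (simp add: valuation_def s_def e(1))
    then have "real p powr ((real p - 2) * valuation p (q - 1)) = s powr - real e"
      using \<open>p > 2\<close> \<open>s > 0\<close> by (simp only: powr_powr[symmetric]) simp
    also have "\<dots> = inverse (s ^ e)"
      using \<open>s > 0\<close> by (simp add: powr_minus powr_realpow)
    finally show ?thesis
      using \<open>p > 2\<close> by (simp add: A powr_diff)
  qed

  show ?thesis
    using degree image formula unfolding e_def[symmetric] exp_radius_def by blast
qed

end
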